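(* A subsequence of the (extended) warping functions $f_j$ converges uniformly on $[0,D]$ to a Lipschitz function $f_\infty$ with Lipschitz constant $1$, which satisfies: (i) $f_\infty(0)=0$ and $f_\infty$ is nondecreasing on $[0,A_\infty]$; (ii) $f_\infty\ge\sqrt{A/4\pi}$ on $[A_\infty,B_\infty]$ if $A_\infty\ne B_\infty$; (iii) $f_\infty(D)=0$ and $f_\infty$ is nonincreasing on $[B_\infty,D]$.
   Context: Let $D,A>0$. For $j\in\mathbb N$, $M_j$ is diffeomorphic to $\mathbb S^3$ with a smooth rotationally symmetric metric $g_j=ds^2+f_j(s)^2g_{\mathbb S^2}$, $0\le s\le D_j$, where $g_{\mathbb S^2}$ is the round unit-sphere metric and $f_j$ is smooth on $[0,D_j]$ with $f_j(0)=f_j(D_j)=0$, $f_j>0$ on $(0,D_j)$, $f_j'(0)=1$, $f_j'(D_j)=-1$. Assume for all $j$ that $\operatorname{Diam}(M_j)\le D$ (so $D_j\le D$), the scalar curvature satisfies $\operatorname{Scalar}_j\ge0$, and $\operatorname{MinA}(M_j)\ge A>0$, where $\operatorname{MinA}(M_j)$ is the infimum of areas of closed embedded minimal surfaces in $M_j$. Extend $f_j$ to $[0,D]$ by $f_j=0$ on $[D_j,D]$. Define $0<A_j\le B_j<D_j$ by $A_j=\sup\{s: f_j\text{ is strictly increasing on }[0,s]\}$ and $B_j=\inf\{s: f_j\text{ is strictly decreasing on }[s,D_j]\}$. Pass to a subsequence along which $A_j\to A_\infty$ and $B_j\to B_\infty$, so $0\le A_\infty\le B_\infty\le D$. *)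

theory Defs
  imports "HOL-Analysis.Analysis"
begin

section \<open>Smooth maps\<close>

text \<open>Derivatives are taken within \<open>S\<close>. They are unique for the two kinds of \<open>S\<close> used below: open
  sets and nondegenerate compact intervals (where one gets one-sided derivatives at the ends).\<close>

primrec Ck_on :: "nat \<Rightarrow> 'a::real_normed_vector set \<Rightarrow> ('a \<Rightarrow> 'b::real_normed_vector) \<Rightarrow> bool" where
  "Ck_on 0 S f \<longleftrightarrow> continuous_on S f"
| "Ck_on (Suc k) S f \<longleftrightarrow>
     f differentiable_on S \<and> (\<forall>v. Ck_on k S (\<lambda>x. frechet_derivative f (at x within S) v))"

definition smooth_on :: "'a::real_normed_vector set \<Rightarrow> ('a \<Rightarrow> 'b::real_normed_vector) \<Rightarrow> bool" where
  "smooth_on S f \<longleftrightarrow> (\<forall>k. Ck_on k S f)"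

definition pd :: "'n::finite \<Rightarrow> (real^'n \<Rightarrow> 'b::real_normed_vector) \<Rightarrow> real^'n \<Rightarrow> 'b" where
  "pd i h u = frechet_derivative h (at u) (axis i 1)"


section \<open>Embedded submanifolds and metric tensors\<close>

text \<open>Local parametrizations of an embedded submanifold of Euclidean space (inverses of charts).\<close>

definition local_param ::
    "'a::euclidean_space set \<Rightarrow> (real^'n::finite) set \<Rightarrow> (real^'n \<Rightarrow> 'a) \<Rightarrow> bool" where
  "local_param M U \<phi> \<longleftrightarrow>
     open U \<and> smooth_on U \<phi> \<and> (\<forall>u\<in>U. inj (frechet_derivative \<phi> (at u))) \<and>
     openin (top_of_set M) (\<phi> ` U) \<and> (\<exists>\<psi>. homeomorphism U (\<phi> ` U) \<phi> \<psi>)"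

type_synonym 'a tensor2 = "'a \<Rightarrow> 'a \<Rightarrow> 'a \<Rightarrow> real"

definition pullback ::
    "'b::real_normed_vector tensor2 \<Rightarrow> ('a::real_normed_vector \<Rightarrow> 'b) \<Rightarrow> 'a tensor2" where
  "pullback g \<phi> u v w =
     g (\<phi> u) (frechet_derivative \<phi> (at u) v) (frechet_derivative \<phi> (at u) w)"

definition tensor_matrix :: "(real^'n::finite) tensor2 \<Rightarrow> real^'n \<Rightarrow> real^'n^'n" where
  "tensor_matrix m u = (\<chi> i j. m u (axis i 1) (axis j 1))"


section \<open>Levi-Civita connection and scalar curvature in coordinates\<close>

definition christoffel ::
    "(real^'n::finite) tensor2 \<Rightarrow> 'n \<Rightarrow> 'n \<Rightarrow> 'n \<Rightarrow> real^'n \<Rightarrow> real" where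
  "christoffel m k i j u =
     (\<Sum>l\<in>UNIV. matrix_inv (tensor_matrix m u) $ k $ l *
        (pd i (\<lambda>x. tensor_matrix m x $ j $ l) u + pd j (\<lambda>x. tensor_matrix m x $ i $ l) u
         - pd l (\<lambda>x. tensor_matrix m x $ i $ j) u)) / 2"

text \<open>Sign convention: the unit \<open>n\<close>-sphere has Ricci tensor \<open>(n - 1) g\<close>.\<close>

definition ricci :: "(real^'n::finite) tensor2 \<Rightarrow> 'n \<Rightarrow> 'n \<Rightarrow> real^'n \<Rightarrow> real" where
  "ricci m i j u =
     (\<Sum>k\<in>UNIV. pd k (christoffel m k i j) u - pd j (christoffel m k i k) u)
     + (\<Sum>k\<in>UNIV. \<Sum>l\<in>UNIV. christoffel m k k l u * christoffel m l i j u
                          - christoffel m k j l u * christoffel m l i k u)"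

definition scalar_curvature :: "(real^'n::finite) tensor2 \<Rightarrow> real^'n \<Rightarrow> real" where
  "scalar_curvature m u =
     (\<Sum>i\<in>UNIV. \<Sum>j\<in>UNIV. matrix_inv (tensor_matrix m u) $ i $ j * ricci m i j u)"


section \<open>Riemannian metrics on the three-sphere\<close>

type_synonym pt = "real \<times> (real^3)"

definition S3 :: "pt set" where
  "S3 = sphere 0 1"

text \<open>A metric is given by bilinear forms on the ambient space; positivity is required, and the
  values are relevant, only on tangent vectors. Every tensor field on the tangent
  spaces has such an extension.\<close>

definition riemannian_metric :: "pt tensor2 \<Rightarrow> bool" where
  "riemannian_metric g \<longleftrightarrow>
     (\<forall>p\<in>S3. bilinear (g p) \<and> (\<forall>v w. g p v w = g p w v) \<and>
            (\<forall>v. p \<bullet> v = 0 \<and> v \<noteq> 0 \<longrightarrow> 0 < g p v v)) \<and>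
     (\<forall>U (\<phi> :: real^3 \<Rightarrow> pt). local_param S3 U \<phi> \<longrightarrow>
            smooth_on U (tensor_matrix (pullback g \<phi>)))"

definition nonneg_scalar_curvature :: "pt tensor2 \<Rightarrow> bool" where
  "nonneg_scalar_curvature g \<longleftrightarrow>
     (\<forall>U (\<phi> :: real^3 \<Rightarrow> pt). local_param S3 U \<phi> \<longrightarrow>
            (\<forall>u\<in>U. 0 \<le> scalar_curvature (pullback g \<phi>) u))"

definition curve_length :: "pt tensor2 \<Rightarrow> (real \<Rightarrow> pt) \<Rightarrow> ennreal" where
  "curve_length g \<gamma> = (\<integral>\<^sup>+t\<in>{0..1}.
     ennreal (sqrt (g (\<gamma> t) (vector_derivative \<gamma> (at t)) (vector_derivative \<gamma> (at t)))) \<partial>lborel)"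

definition riemannian_dist :: "pt tensor2 \<Rightarrow> pt \<Rightarrow> pt \<Rightarrow> ennreal" where
  "riemannian_dist g p q =
     Inf {curve_length g \<gamma> | \<gamma>.
            valid_path \<gamma> \<and> path_image \<gamma> \<subseteq> S3 \<and> pathstart \<gamma> = p \<and> pathfinish \<gamma> = q}"

definition Diam :: "pt tensor2 \<Rightarrow> ennreal" where
  "Diam g = (SUP p\<in>S3. SUP q\<in>S3. riemannian_dist g p q)"


section \<open>Minimal surfaces\<close>

definition closed_embedded_surface :: "pt set \<Rightarrow> bool" where
  "closed_embedded_surface \<Sigma> \<longleftrightarrow>
     \<Sigma> \<subseteq> S3 \<and> \<Sigma> \<noteq> {} \<and> compact \<Sigma> \<and> connected \<Sigma> \<and>
     (\<forall>p\<in>\<Sigma>. \<exists>V (X :: real^2 \<Rightarrow> pt). local_param \<Sigma> V X \<and> p \<in> X ` V)"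

text \<open>Area, computed from a finite Borel partition of the surface into pieces of coordinate
  patches. The value does not depend on the choices, by the change of variables formula.\<close>

definition has_area :: "pt tensor2 \<Rightarrow> pt set \<Rightarrow> ennreal \<Rightarrow> bool" where
  "has_area g \<Sigma> a \<longleftrightarrow>
     (\<exists>(n::nat) V (X :: nat \<Rightarrow> real^2 \<Rightarrow> pt) E.
        (\<forall>i<n. local_param \<Sigma> (V i) (X i) \<and> E i \<in> sets borel \<and> E i \<subseteq> X i ` V i) \<and>
        disjoint_family_on E {..<n} \<and> (\<Union>i<n. E i) = \<Sigma> \<and>
        a = (\<Sum>i<n. \<integral>\<^sup>+u\<in>{u \<in> V i. X i u \<in> E i}.
               ennreal (sqrt (det (tensor_matrix (pullback g (X i)) u))) \<partial>lborel))"

text \<open>For a map \<open>Y\<close> from \<open>\<real>\<^sup>2\<close> to a coordinate domain in \<open>\<real>\<^sup>3\<close> with metric \<open>m\<close>, this is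
  the vector \<open>h\<^sup>a\<^sup>b \<nabla>\<^sub>a \<partial>\<^sub>b Y\<close>, with \<open>h\<close> the induced metric. Its normal part is the
  mean curvature vector.\<close>

definition trace_hessian ::
    "(real^3) tensor2 \<Rightarrow> (real^2 \<Rightarrow> real^3) \<Rightarrow> real^2 \<Rightarrow> real^3" where
  "trace_hessian m Y u =
     (\<chi> k. \<Sum>a\<in>UNIV. \<Sum>b\<in>UNIV. matrix_inv (tensor_matrix (pullback m Y) u) $ a $ b *
        (pd a (\<lambda>x. pd b Y x $ k) u +
         (\<Sum>i\<in>UNIV. \<Sum>j\<in>UNIV. christoffel m k i j (Y u) * (pd a Y u $ i) * (pd b Y u $ j))))"

definition zero_mean_curvature ::
    "(real^3) tensor2 \<Rightarrow> (real^2 \<Rightarrow> real^3) \<Rightarrow> real^2 \<Rightarrow> bool" where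
  "zero_mean_curvature m Y u \<longleftrightarrow>
     (\<forall>n. (\<forall>a. m (Y u) n (pd a Y u) = 0) \<longrightarrow> m (Y u) n (trace_hessian m Y u) = 0)"

text \<open>Vanishing of the mean curvature does not depend on the local coordinates \<open>\<phi>\<close> of the
  three-sphere or on the parametrization \<open>\<phi> \<circ> Y\<close> of the surface.\<close>

definition closed_embedded_minimal_surface :: "pt tensor2 \<Rightarrow> pt set \<Rightarrow> bool" where
  "closed_embedded_minimal_surface g \<Sigma> \<longleftrightarrow>
     closed_embedded_surface \<Sigma> \<and>
     (\<forall>p\<in>\<Sigma>. \<exists>U (\<phi> :: real^3 \<Rightarrow> pt) V Y.
        local_param S3 U \<phi> \<and> smooth_on V Y \<and> Y ` V \<subseteq> U \<and> local_param \<Sigma> V (\<phi> \<circ> Y) \<and>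
        p \<in> \<phi> ` Y ` V \<and> (\<forall>u\<in>V. zero_mean_curvature (pullback g \<phi>) Y u))"

definition MinA :: "pt tensor2 \<Rightarrow> ennreal" where
  "MinA g = Inf {a. \<exists>\<Sigma>. closed_embedded_minimal_surface g \<Sigma> \<and> has_area g \<Sigma> a}"


section \<open>Rotationally symmetric metrics\<close>

text \<open>Polar coordinates \<open>(s, \<omega>)\<close> on the three-sphere, with \<open>0 \<le> s \<le> d\<close> and \<open>\<omega>\<close> in the
  unit two-sphere. The poles are \<open>s = 0\<close> and \<open>s = d\<close>.\<close>

definition polar :: "real \<Rightarrow> real \<times> (real^3) \<Rightarrow> pt" where
  "polar d = (\<lambda>(s, \<omega>). (cos (pi * s / d), sin (pi * s / d) *\<^sub>R \<omega>))"

text \<open>\<open>g = ds\<^sup>2 + f(s)\<^sup>2 g\<^sub>S\<close>, with \<open>g\<^sub>S\<close> the round metric of the unit two-sphere, whose tangent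
  vectors at \<open>\<omega>\<close> are the \<open>\<xi>\<close> orthogonal to \<open>\<omega>\<close>. Smoothness of \<open>g\<close> at the poles is part of
  \<^const>\<open>riemannian_metric\<close>.\<close>

definition rot_symmetric :: "pt tensor2 \<Rightarrow> real \<Rightarrow> (real \<Rightarrow> real) \<Rightarrow> bool" where
  "rot_symmetric g d f \<longleftrightarrow>
     0 < d \<and> smooth_on {0..d} f \<and> f 0 = 0 \<and> f d = 0 \<and> (\<forall>s. 0 < s \<and> s < d \<longrightarrow> 0 < f s) \<and>
     (f has_real_derivative 1) (at 0 within {0..d}) \<and>
     (f has_real_derivative -1) (at d within {0..d}) \<and>
     riemannian_metric g \<and>
     (\<forall>s \<omega> a b \<xi> \<eta>. 0 < s \<and> s < d \<and> norm \<omega> = 1 \<and> \<omega> \<bullet> \<xi> = 0 \<and> \<omega> \<bullet> \<eta> = 0 \<longrightarrow>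
        pullback g (polar d) (s, \<omega>) (a, \<xi>) (b, \<eta>) = a * b + (f s)\<^sup>2 * (\<xi> \<bullet> \<eta>))"

definition extend_by_zero :: "real \<Rightarrow> (real \<Rightarrow> real) \<Rightarrow> real \<Rightarrow> real" where
  "extend_by_zero d f s = (if s \<le> d then f s else 0)"

definition increasing_end :: "real \<Rightarrow> (real \<Rightarrow> real) \<Rightarrow> real" where
  "increasing_end d f = Sup {s \<in> {0..d}. strict_mono_on {0..s} f}"

definition decreasing_start :: "real \<Rightarrow> (real \<Rightarrow> real) \<Rightarrow> real" where
  "decreasing_start d f = Inf {s \<in> {0..d}. strict_antimono_on {s..d} f}"

end

theory Submission
  imports Defs "HOL-Complex_Analysis.Great_Picard"
begin

text \<open>The proof rests on two pointwise facts about a warping function \<open>f\<close> on \<open>[0, d]\<close>.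

Scalar curvature. In the metric \<open>ds\<^sup>2 + f(s)\<^sup>2 g\<^sub>S\<close> the scalar curvature at radius \<open>s\<close> is
\<open>- 4 f''/f + 2 (1 - f'\<^sup>2)/f\<^sup>2\<close> (\<open>scalar_curvature_chart\<close>). At an interior extremum of the slope \<open>f'\<close>
the first term vanishes, so nonnegativity forces \<open>\<bar>f'\<bar> \<le> 1\<close> there; at the two ends the slope is
\<open>1\<close> and \<open>-1\<close>. Hence \<open>f\<close> is 1-Lipschitz (\<open>slope_bound\<close>).

Minimal surfaces. If \<open>f'(s) = 0\<close>, the latitude sphere at radius \<open>s\<close> is a closed embedded minimal
surface of area \<open>4\<pi> f(s)\<^sup>2\<close>, so the bound on \<open>MinA\<close> gives \<open>f(s) \<ge> \<surd>(A/4\<pi>)\<close> at every critical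
point (\<open>critical_radius_bound\<close>). The end \<open>a\<close> of the initial increasing stretch and the start \<open>b\<close> of
the final decreasing stretch are themselves critical points, and any other minimum of \<open>f\<close> on
\<open>[a, b]\<close> is one as well. So the lower bound holds on all of \<open>[a, b]\<close> (\<open>F_ge\<close>).

Both computations are made in one chart \<open>(s, z, p)\<close>, where \<open>(z, p)\<close> are height and angle on the unit
two-sphere (the equal-area cylindrical projection). There the metric is the diagonal matrix with
entries \<open>1\<close>, \<open>f\<^sup>2/(1 - z\<^sup>2)\<close>, \<open>f\<^sup>2 (1 - z\<^sup>2)\<close>, and the area element of a latitude sphere is the
constant \<open>f\<^sup>2\<close> on a rectangle of area \<open>4\<pi>\<close>.

A path between the two poles has length at least \<open>d\<close>, because its speed dominates the rate of
change of \<open>s\<close>; therefore \<open>d \<le> D\<close> (\<open>Diam_ge\<close>), and the extension by zero vanishes at \<open>D\<close>. The extended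
functions are 1-Lipschitz and vanish at \<open>0\<close>, so the theorem of Arzela and Ascoli yields a uniformly
convergent subsequence. Monotonicity and the lower bound hold for each function on its own
intervals. They pass to the limit because the interval ends converge and all functions share the
Lipschitz constant \<open>1\<close>.\<close>

section \<open>Smooth maps on open sets\<close>

lemma Ck_on_cong:
  assumes "open S" "\<And>x. x \<in> S \<Longrightarrow> f x = g x"
  shows "Ck_on k S f = Ck_on k S g"
  using assms(2)
proof (induction k arbitrary: f g)
  case 0
  then show ?case by (simp cong: continuous_on_cong)
next
  case (Suc k)
  have "(f has_derivative D) (at x within S) = (g has_derivative D) (at x within S)"
    if "x \<in> S" for x D
    using Suc.prems that by (metis has_derivative_transform)
  then have fr: "frechet_derivative f (at x within S) = frechet_derivative g (at x within S)"
    and df: "f differentiable (at x within S) \<longleftrightarrow> g differentiable (at x within S)" if "x \<in> S" for x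
    using that by (auto simp: frechet_derivative_def differentiable_def)
  have "Ck_on k S (\<lambda>x. frechet_derivative f (at x within S) v) =
      Ck_on k S (\<lambda>x. frechet_derivative g (at x within S) v)" for v
    by (rule Suc.IH) (simp add: fr)
  then show ?case using df by (simp add: differentiable_on_def)
qed

text \<open>On an open set the derivative within the set is the ordinary derivative, so any derivative found
by calculus may be used in the recursion that defines \<^const>\<open>Ck_on\<close>.\<close>

lemma Ck_on_SucI:
  assumes "open S" "\<And>x. x \<in> S \<Longrightarrow> (f has_derivative D x) (at x)"
    and "\<And>v. Ck_on k S (\<lambda>x. D x v)"
  shows "Ck_on (Suc k) S f"
proof -
  have "frechet_derivative f (at x within S) = D x" if "x \<in> S" for x
    using assms(1,2) that frechet_derivative_at by (metis at_within_open)
  then have "Ck_on k S (\<lambda>x. frechet_derivative f (at x within S) v)" for v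
    using assms(1,3) by (subst Ck_on_cong[where g = "\<lambda>x. D x v"]) auto
  moreover have "f differentiable_on S"
    using assms(1,2) by (auto simp: differentiable_on_def differentiable_def intro: has_derivative_at_withinI)
  ultimately show ?thesis by simp
qed

lemma Ck_on_SucD:
  assumes "open S" "Ck_on (Suc k) S f"
  shows "\<exists>D. (\<forall>x\<in>S. (f has_derivative D x) (at x)) \<and> (\<forall>v. Ck_on k S (\<lambda>x. D x v))"
proof (intro exI conjI ballI)
  show "(f has_derivative frechet_derivative f (at x within S)) (at x)" if "x \<in> S" for x
    using assms that frechet_derivative_works[THEN iffD1, of f "at x within S"]
    by (metis Ck_on.simps(2) at_within_open differentiable_on_def)
qed (use assms(2) in auto)

lemma Ck_on_Suc_imp: "Ck_on (Suc k) S f \<Longrightarrow> Ck_on k S f"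
proof (induction k arbitrary: f)
  case 0
  then show ?case by (simp add: differentiable_imp_continuous_on)
next
  case (Suc k)
  then show ?case unfolding Ck_on.simps(2)[of "Suc k"] Ck_on.simps(2)[of k S f] by blast
qed

lemma Ck_on_const: "open S \<Longrightarrow> Ck_on k S (\<lambda>x. c)"
proof (induction k arbitrary: c)
  case (Suc k)
  then show ?case by (intro Ck_on_SucI[where D = "\<lambda>_ _. 0"]) auto
qed simp

lemma Ck_on_linear: "open S \<Longrightarrow> bounded_linear f \<Longrightarrow> Ck_on k S f"
proof (cases k)
  case (Suc n)
  assume "open S" "bounded_linear f"
  then show ?thesis
    unfolding Suc
    by (intro Ck_on_SucI[where D = "\<lambda>_. f"]) (auto intro: Ck_on_const bounded_linear_imp_has_derivative)
qed (simp add: linear_continuous_on)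

lemma Ck_on_add:
  assumes "open S" shows "Ck_on k S f \<Longrightarrow> Ck_on k S g \<Longrightarrow> Ck_on k S (\<lambda>x. f x + g x)"
proof (induction k arbitrary: f g)
  case (Suc k)
  obtain F where F: "\<forall>x\<in>S. (f has_derivative F x) (at x)" "\<forall>v. Ck_on k S (\<lambda>x. F x v)"
    using Ck_on_SucD[OF assms Suc.prems(1)] by (elim exE conjE)
  obtain G where G: "\<forall>x\<in>S. (g has_derivative G x) (at x)" "\<forall>v. Ck_on k S (\<lambda>x. G x v)"
    using Ck_on_SucD[OF assms Suc.prems(2)] by (elim exE conjE)
  show ?case
  proof (rule Ck_on_SucI[OF assms])
    show "((\<lambda>x. f x + g x) has_derivative (\<lambda>v. F x v + G x v)) (at x)" if "x \<in> S" for x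
      using F G that by (simp add: has_derivative_add)
    show "Ck_on k S (\<lambda>x. F x v + G x v)" for v
      by (rule Suc.IH) (simp_all add: F G)
  qed
qed (unfold Ck_on.simps, rule continuous_on_add)

lemma Ck_on_scaleR:
  assumes "open S" shows "Ck_on k S f \<Longrightarrow> Ck_on k S g \<Longrightarrow> Ck_on k S (\<lambda>x. f x *\<^sub>R g x)"
proof (induction k arbitrary: f g)
  case (Suc k)
  obtain F where F: "\<forall>x\<in>S. (f has_derivative F x) (at x)" "\<forall>v. Ck_on k S (\<lambda>x. F x v)"
    using Ck_on_SucD[OF assms Suc.prems(1)] by (elim exE conjE)
  obtain G where G: "\<forall>x\<in>S. (g has_derivative G x) (at x)" "\<forall>v. Ck_on k S (\<lambda>x. G x v)"
    using Ck_on_SucD[OF assms Suc.prems(2)] by (elim exE conjE)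
  show ?case
  proof (rule Ck_on_SucI[OF assms])
    show "((\<lambda>x. f x *\<^sub>R g x) has_derivative (\<lambda>v. f x *\<^sub>R G x v + F x v *\<^sub>R g x)) (at x)"
      if "x \<in> S" for x
      using F G that by (simp add: has_derivative_scaleR)
    have "Ck_on k S (\<lambda>x. f x *\<^sub>R G x v)" "Ck_on k S (\<lambda>x. F x v *\<^sub>R g x)" for v
      using F G Suc.IH Ck_on_Suc_imp[OF Suc.prems(1)] Ck_on_Suc_imp[OF Suc.prems(2)] by simp_all
    then show "Ck_on k S (\<lambda>x. f x *\<^sub>R G x v + F x v *\<^sub>R g x)" for v
      by (rule Ck_on_add[OF assms])
  qed
qed (unfold Ck_on.simps, rule continuous_on_scaleR)

text \<open>Composition with a function of one real variable suffices for all maps below. Giving the outer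
function together with the whole sequence \<open>h\<close> of its derivatives makes the induction uniform: the
derivative of \<open>h n \<circ> g\<close> is a product of \<open>h (n + 1) \<circ> g\<close> with a derivative of \<open>g\<close>.\<close>

lemma Ck_on_compose_real:
  fixes h :: "nat \<Rightarrow> real \<Rightarrow> real"
  assumes "open S" and h: "\<And>n y. y \<in> T \<Longrightarrow> (h n has_real_derivative h (Suc n) y) (at y)"
    and g: "\<And>x. x \<in> S \<Longrightarrow> g x \<in> T"
  shows "Ck_on k S g \<Longrightarrow> Ck_on k S (\<lambda>x. h n (g x))"
proof (induction k arbitrary: n)
  case 0
  have "continuous_on T (h n)"
    using h DERIV_isCont continuous_at_imp_continuous_on by blast
  then show ?case
    using 0 g continuous_on_compose2[of T "h n" S g] by (simp add: image_subset_iff)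
next
  case (Suc k)
  obtain G where G: "\<forall>x\<in>S. (g has_derivative G x) (at x)" "\<forall>v. Ck_on k S (\<lambda>x. G x v)"
    using Ck_on_SucD[OF assms(1) Suc.prems] by (elim exE conjE)
  show ?case
  proof (rule Ck_on_SucI[OF assms(1)])
    show "((\<lambda>x. h n (g x)) has_derivative (\<lambda>v. h (Suc n) (g x) *\<^sub>R G x v)) (at x)" if "x \<in> S" for x
      using has_derivative_compose[OF G(1)[rule_format, OF that]
          h[OF g[OF that], of n, unfolded has_field_derivative_def]]
      by simp
    show "Ck_on k S (\<lambda>x. h (Suc n) (g x) *\<^sub>R G x v)" for v
      by (rule Ck_on_scaleR[OF assms(1) Suc.IH[OF Ck_on_Suc_imp[OF Suc.prems]] G(2)[rule_format]])
  qed
qed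

lemma smooth_on_const: "open S \<Longrightarrow> smooth_on S (\<lambda>x. c)"
  by (simp add: smooth_on_def Ck_on_const)

lemma smooth_on_linear: "open S \<Longrightarrow> bounded_linear f \<Longrightarrow> smooth_on S f"
  by (simp add: smooth_on_def Ck_on_linear)

lemma smooth_on_add: "open S \<Longrightarrow> smooth_on S f \<Longrightarrow> smooth_on S g \<Longrightarrow> smooth_on S (\<lambda>x. f x + g x)"
  by (simp add: smooth_on_def Ck_on_add)

lemma smooth_on_scaleR:
  "open S \<Longrightarrow> smooth_on S f \<Longrightarrow> smooth_on S g \<Longrightarrow> smooth_on S (\<lambda>x. f x *\<^sub>R g x)"
  by (simp add: smooth_on_def Ck_on_scaleR)

lemma smooth_on_mult:
  fixes f g :: "_ \<Rightarrow> real"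
  shows "open S \<Longrightarrow> smooth_on S f \<Longrightarrow> smooth_on S g \<Longrightarrow> smooth_on S (\<lambda>x. f x * g x)"
  using smooth_on_scaleR[of S f g] by simp

lemma smooth_on_sin:
  fixes g :: "_ \<Rightarrow> real"
  assumes "open S" "smooth_on S g" shows "smooth_on S (\<lambda>x. sin (g x))"
proof -
  \<comment> \<open>Each derivative of the sine shifts its argument by \<open>\<pi>/2\<close>.\<close>
  define h :: "nat \<Rightarrow> real \<Rightarrow> real" where "h n y = sin (y + real n * (pi / 2))" for n y
  have "cos t = sin (t + pi / 2)" for t :: real by (simp add: sin_add)
  then have h: "(h n has_real_derivative h (Suc n) y) (at y)" for n y
    unfolding h_def by (auto intro!: derivative_eq_intros simp: distrib_right add_ac add_divide_distrib)
  have "Ck_on k S (\<lambda>x. h 0 (g x))" for k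
    by (rule Ck_on_compose_real[where T = UNIV]) (use assms h in \<open>auto simp: smooth_on_def\<close>)
  then show ?thesis by (simp add: smooth_on_def h_def)
qed

lemma smooth_on_cos:
  fixes g :: "_ \<Rightarrow> real"
  assumes "open S" "smooth_on S g" shows "smooth_on S (\<lambda>x. cos (g x))"
proof -
  have "smooth_on S (\<lambda>x. sin (g x + pi / 2))"
    by (intro smooth_on_sin smooth_on_add smooth_on_const assms)
  then show ?thesis by (simp add: sin_add)
qed

lemma smooth_on_sqrt:
  fixes g :: "_ \<Rightarrow> real"
  assumes "open S" "smooth_on S g" "\<And>x. x \<in> S \<Longrightarrow> 0 < g x"
  shows "smooth_on S (\<lambda>x. sqrt (g x))"
proof -
  \<comment> \<open>The derivatives of \<open>y powr (1/2)\<close>, with their falling factorial coefficients.\<close>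
  define h :: "nat \<Rightarrow> real \<Rightarrow> real"
    where "h n y = (\<Prod>i<n. 1/2 - real i) * y powr (1/2 - real n)" for n y
  have h: "(h n has_real_derivative h (Suc n) y) (at y)" if "0 < y" for n y
    unfolding h_def using that
    by (auto intro!: derivative_eq_intros simp: algebra_simps)
  have "Ck_on k S (\<lambda>x. h 0 (g x))" for k
    by (rule Ck_on_compose_real[where T = "{0<..}"]) (use assms h in \<open>auto simp: smooth_on_def\<close>)
  moreover have "Ck_on k S (\<lambda>x. h 0 (g x)) = Ck_on k S (\<lambda>x. sqrt (g x))" for k
    using assms by (intro Ck_on_cong) (simp_all add: h_def powr_half_sqrt less_imp_le)
  ultimately show ?thesis by (simp add: smooth_on_def)
qed

section \<open>Cylindrical charts of the three-sphere\<close>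

text \<open>Height \<open>z\<close> and angle \<open>p\<close> on the unit two-sphere. This is the inverse of Archimedes' (Lambert's)
projection to the cylinder, which preserves area.\<close>

definition cyl :: "real \<Rightarrow> real \<Rightarrow> real^3" where
  "cyl z p = (sqrt (1 - z\<^sup>2) * cos p) *\<^sub>R axis 1 1 + (sqrt (1 - z\<^sup>2) * sin p) *\<^sub>R axis 2 1 + z *\<^sub>R axis 3 1"

text \<open>The linear isometry \<open>R\<close> turns the two-sphere. A single chart misses a half great circle of each
latitude sphere, and a second choice of \<open>R\<close> covers it.\<close>

definition chart :: "real \<Rightarrow> (real^3 \<Rightarrow> real^3) \<Rightarrow> real^3 \<Rightarrow> pt" where
  "chart d R u = polar d (u $ 1, R (cyl (u $ 2) (u $ 3)))"

definition chart_dom :: "real \<Rightarrow> (real^3) set" where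
  "chart_dom d = {u. 0 < u $ 1 \<and> u $ 1 < d \<and> \<bar>u $ 2\<bar> < 1 \<and> \<bar>u $ 3\<bar> < pi}"

lemma cyl_nth [simp]:
  "cyl z p $ 1 = sqrt (1 - z\<^sup>2) * cos p" "cyl z p $ 2 = sqrt (1 - z\<^sup>2) * sin p" "cyl z p $ 3 = z"
  by (simp_all add: cyl_def axis_def)

lemma inner_real3: "(x::real^3) \<bullet> y = x $ 1 * y $ 1 + x $ 2 * y $ 2 + x $ 3 * y $ 3"
  by (simp add: inner_vec_def sum_3)

lemma abs_less_one_sq: "\<bar>z::real\<bar> < 1 \<Longrightarrow> z\<^sup>2 < 1"
  by (simp add: abs_square_less_1)

lemma norm_cyl: "\<bar>z\<bar> \<le> 1 \<Longrightarrow> norm (cyl z p) = 1"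
proof -
  assume "\<bar>z\<bar> \<le> 1"
  then have "z\<^sup>2 \<le> 1" by (simp add: abs_square_le_1)
  define r where "r = sqrt (1 - z\<^sup>2)"
  have "cyl z p $ 1 = r * cos p" "cyl z p $ 2 = r * sin p" by (simp_all add: r_def)
  then have "cyl z p \<bullet> cyl z p = r\<^sup>2 * ((cos p)\<^sup>2 + (sin p)\<^sup>2) + z\<^sup>2"
    by (simp add: inner_real3 power2_eq_square algebra_simps del: cyl_nth(1,2) sin_cos_squared_add sin_cos_squared_add2 sin_cos_squared_add3)
  also have "\<dots> = 1" using \<open>z\<^sup>2 \<le> 1\<close> by (simp add: r_def)
  finally show ?thesis by (simp add: norm_eq_1)
qed

definition cyl_z :: "real \<Rightarrow> real \<Rightarrow> real^3" where
  "cyl_z z p = (- z / sqrt (1 - z\<^sup>2) * cos p) *\<^sub>R axis 1 1 + (- z / sqrt (1 - z\<^sup>2) * sin p) *\<^sub>R axis 2 1 + axis 3 1"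

definition cyl_p :: "real \<Rightarrow> real \<Rightarrow> real^3" where
  "cyl_p z p = (- sqrt (1 - z\<^sup>2) * sin p) *\<^sub>R axis 1 1 + (sqrt (1 - z\<^sup>2) * cos p) *\<^sub>R axis 2 1"

text \<open>The two partial derivatives are tangent to the sphere and orthogonal to each other. Their squared
lengths are reciprocal, which is why the projection preserves area.\<close>

lemma cyl_frame:
  assumes "\<bar>z\<bar> < 1"
  shows "cyl_z z p \<bullet> cyl_z z p = 1 / (1 - z\<^sup>2)" "cyl_p z p \<bullet> cyl_p z p = 1 - z\<^sup>2"
    "cyl_z z p \<bullet> cyl_p z p = 0" "cyl z p \<bullet> cyl_z z p = 0" "cyl z p \<bullet> cyl_p z p = 0"
proof -
  define r where "r = sqrt (1 - z\<^sup>2)"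
  have z2: "z\<^sup>2 < 1" using assms by (rule abs_less_one_sq)
  have r: "r > 0" and r2: "1 - z\<^sup>2 = r\<^sup>2" using z2 by (auto simp: r_def)
  define c s where "c = cos p" and "s = sin p"
  have cs: "c\<^sup>2 = 1 - s\<^sup>2" by (simp add: c_def s_def cos_squared_eq)
  have zr: "z\<^sup>2 = 1 - r\<^sup>2" using r2 by simp
  have n: "cyl_z z p $ 1 = - z / r * c" "cyl_z z p $ 2 = - z / r * s" "cyl_z z p $ 3 = 1"
    "cyl_p z p $ 1 = - r * s" "cyl_p z p $ 2 = r * c" "cyl_p z p $ 3 = 0"
    "cyl z p $ 1 = r * c" "cyl z p $ 2 = r * s"
    by (simp_all add: cyl_z_def cyl_p_def axis_def r_def c_def s_def)
  have "cyl_z z p \<bullet> cyl_z z p = z\<^sup>2 / r\<^sup>2 * (c\<^sup>2 + s\<^sup>2) + 1"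
    by (simp add: inner_real3 n power2_eq_square distrib_left add_divide_distrib mult_ac)
  also have "\<dots> = 1 / r\<^sup>2" using r by (simp add: cs zr field_simps)
  finally show "cyl_z z p \<bullet> cyl_z z p = 1 / (1 - z\<^sup>2)" by (simp add: r2)
  have "cyl_p z p \<bullet> cyl_p z p = r\<^sup>2 * (c\<^sup>2 + s\<^sup>2)"
    by (simp add: inner_real3 n power2_eq_square algebra_simps)
  then show "cyl_p z p \<bullet> cyl_p z p = 1 - z\<^sup>2" by (simp add: r2 cs)
  show "cyl_z z p \<bullet> cyl_p z p = 0" "cyl z p \<bullet> cyl_p z p = 0"
    by (simp_all add: inner_real3 n del: cyl_nth(1,2))
  have "cyl z p \<bullet> cyl_z z p = - z * (c\<^sup>2 + s\<^sup>2) + z"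
    using r by (simp add: inner_real3 n power2_eq_square algebra_simps del: cyl_nth(1,2))
  then show "cyl z p \<bullet> cyl_z z p = 0" by (simp add: cs)
qed

lemma cyl_has_derivative:
  assumes "(b has_derivative b') (at u)" "(c has_derivative c') (at u)" "\<bar>b u\<bar> < 1"
  shows "((\<lambda>u. cyl (b u) (c u)) has_derivative
    (\<lambda>v. b' v *\<^sub>R cyl_z (b u) (c u) + c' v *\<^sub>R cyl_p (b u) (c u))) (at u)"
proof -
  have "0 < 1 - (b u)\<^sup>2" using abs_less_one_sq[OF assms(3)] by simp
  then have q: "((\<lambda>u. sqrt (1 - (b u)\<^sup>2)) has_derivative (\<lambda>v. - (b u / sqrt (1 - (b u)\<^sup>2) * b' v))) (at u)"
    by (auto intro!: derivative_eq_intros assms(1) simp: field_simps)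
  show ?thesis unfolding cyl_def
    by (rule has_derivative_eq_rhs,
        (rule has_derivative_add has_derivative_scaleR_left has_derivative_mult q assms
          has_derivative_cos has_derivative_sin)+)
      (auto simp: cyl_z_def cyl_p_def algebra_simps fun_eq_iff scaleR_add_left)
qed

lemma polar_has_derivative:
  "d \<noteq> 0 \<Longrightarrow> (polar d has_derivative (\<lambda>(a, \<xi>). (- sin (pi * s / d) * (pi * a / d),
      sin (pi * s / d) *\<^sub>R \<xi> + (cos (pi * s / d) * (pi * a / d)) *\<^sub>R \<omega>))) (at (s, \<omega>))"
proof -
  assume d: "d \<noteq> 0"
  have "((\<lambda>x. (cos (pi * fst x / d), sin (pi * fst x / d) *\<^sub>R snd x)) has_derivative
    (\<lambda>x. (- sin (pi * fst (s, \<omega>) / d) * (pi * fst x / d),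
      sin (pi * fst (s, \<omega>) / d) *\<^sub>R snd x + (cos (pi * fst (s, \<omega>) / d) * (pi * fst x / d)) *\<^sub>R snd (s, \<omega>)))) (at (s, \<omega>))"
    by (rule has_derivative_Pair) (use d in \<open>auto intro!: derivative_eq_intros simp: fun_eq_iff\<close>)
  then show ?thesis by (simp add: polar_def case_prod_beta')
qed

lemma polar_frechet:
  "d \<noteq> 0 \<Longrightarrow> (polar d has_derivative frechet_derivative (polar d) (at x)) (at x)"
  using polar_has_derivative[of d "fst x" "snd x"]
  by (auto intro: frechet_derivative_works[THEN iffD1] differentiableI)

text \<open>The defining formula for the metric in polar coordinates applies to the derivatives of any map
whose spherical component \<open>\<omega>\<close> moves tangentially to the unit sphere. It is used for the charts and
for curves on the three-sphere.\<close>

lemma pullback_polar_curve: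
  assumes g: "rot_symmetric g d f"
    and a: "(\<alpha> has_derivative \<alpha>') (at u)" and w: "(\<omega> has_derivative \<omega>') (at u)"
    and "0 < \<alpha> u" "\<alpha> u < d" "norm (\<omega> u) = 1" "\<omega> u \<bullet> \<omega>' v = 0" "\<omega> u \<bullet> \<omega>' w = 0"
  shows "pullback g (\<lambda>u. polar d (\<alpha> u, \<omega> u)) u v w = \<alpha>' v * \<alpha>' w + (f (\<alpha> u))\<^sup>2 * (\<omega>' v \<bullet> \<omega>' w)"
proof -
  have pol: "\<forall>s \<omega> a b \<xi> \<eta>. 0 < s \<and> s < d \<and> norm \<omega> = 1 \<and> \<omega> \<bullet> \<xi> = 0 \<and> \<omega> \<bullet> \<eta> = 0 \<longrightarrow>
      pullback g (polar d) (s, \<omega>) (a, \<xi>) (b, \<eta>) = a * b + (f s)\<^sup>2 * (\<xi> \<bullet> \<eta>)"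
    using g unfolding rot_symmetric_def by (elim conjE)
  define P where "P = frechet_derivative (polar d) (at (\<alpha> u, \<omega> u))"
  have "((\<lambda>u. polar d (\<alpha> u, \<omega> u)) has_derivative (\<lambda>v. P (\<alpha>' v, \<omega>' v))) (at u)"
    unfolding P_def
    by (rule has_derivative_compose[OF has_derivative_Pair[OF a w] polar_frechet]) (use assms in simp)
  then have "frechet_derivative (\<lambda>u. polar d (\<alpha> u, \<omega> u)) (at u) = (\<lambda>v. P (\<alpha>' v, \<omega>' v))"
    by (rule frechet_derivative_at[symmetric])
  then have "pullback g (\<lambda>u. polar d (\<alpha> u, \<omega> u)) u v w =
      pullback g (polar d) (\<alpha> u, \<omega> u) (\<alpha>' v, \<omega>' v) (\<alpha>' w, \<omega>' w)"
    by (simp add: pullback_def P_def)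
  also have "\<dots> = \<alpha>' v * \<alpha>' w + (f (\<alpha> u))\<^sup>2 * (\<omega>' v \<bullet> \<omega>' w)"
    by (rule pol[rule_format]) (use assms in \<open>intro conjI; simp\<close>)
  finally show ?thesis .
qed

lemma pullback_chart:
  assumes g: "rot_symmetric g d f" and R: "orthogonal_transformation R" and u: "u \<in> chart_dom d"
  shows "pullback g (chart d R) u v w = v $ 1 * w $ 1
     + (f (u $ 1))\<^sup>2 * (v $ 2 * w $ 2 / (1 - (u $ 2)\<^sup>2) + v $ 3 * w $ 3 * (1 - (u $ 2)\<^sup>2))"
proof -
  let ?z = "cyl_z (u $ 2) (u $ 3)" and ?p = "cyl_p (u $ 2) (u $ 3)"
  have nth: "((\<lambda>u::real^3. u $ i) has_derivative (\<lambda>v. v $ i)) (at u)" for i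
    by (rule bounded_linear_imp_has_derivative[OF bounded_linear_vec_nth])
  have lin: "linear R" and inn: "R x \<bullet> R y = x \<bullet> y" and nrm: "norm (R x) = norm x" for x y
    using R by (auto simp: orthogonal_transformation_def orthogonal_transformation_norm)
  have u1: "\<bar>u $ 2\<bar> < 1" using u by (simp add: chart_dom_def)
  have D: "((\<lambda>u. R (cyl (u $ 2) (u $ 3))) has_derivative (\<lambda>v. R (v $ 2 *\<^sub>R ?z + v $ 3 *\<^sub>R ?p))) (at u)"
    by (rule has_derivative_compose[OF cyl_has_derivative[OF nth nth u1]
          linear_imp_has_derivative[OF lin]])
  have c: "chart d R = (\<lambda>u. polar d (u $ 1, R (cyl (u $ 2) (u $ 3))))"
    by (simp add: chart_def fun_eq_iff)
  have o: "R (cyl (u $ 2) (u $ 3)) \<bullet> R (v $ 2 *\<^sub>R ?z + v $ 3 *\<^sub>R ?p) = 0" for v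
    by (simp add: inn inner_add_right cyl_frame[OF u1])
  have "pullback g (chart d R) u v w = v $ 1 * w $ 1
     + (f (u $ 1))\<^sup>2 * (R (v $ 2 *\<^sub>R ?z + v $ 3 *\<^sub>R ?p) \<bullet> R (w $ 2 *\<^sub>R ?z + w $ 3 *\<^sub>R ?p))"
    unfolding c
    by (rule pullback_polar_curve[OF g nth D])
      (use u o u1 in \<open>auto simp: chart_dom_def nrm norm_cyl\<close>)
  also have "R (v $ 2 *\<^sub>R ?z + v $ 3 *\<^sub>R ?p) \<bullet> R (w $ 2 *\<^sub>R ?z + w $ 3 *\<^sub>R ?p) =
      v $ 2 * w $ 2 / (1 - (u $ 2)\<^sup>2) + v $ 3 * w $ 3 * (1 - (u $ 2)\<^sup>2)"
    by (simp add: inn inner_add_left inner_add_right cyl_frame[OF u1] inner_commute[of ?p ?z])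
  finally show ?thesis .
qed

lemma smooth_on_polar_cyl:
  fixes a b c :: "'a::real_normed_vector \<Rightarrow> real"
  assumes S: "open S" and R: "linear R" and sm: "smooth_on S a" "smooth_on S b" "smooth_on S c"
    and b: "\<And>u. u \<in> S \<Longrightarrow> \<bar>b u\<bar> < 1"
  shows "smooth_on S (\<lambda>u. polar d (a u, R (cyl (b u) (c u))))"
proof -
  have sq: "smooth_on S (\<lambda>u. sqrt (1 + (- 1) * (b u * b u)))"
    by (intro smooth_on_sqrt smooth_on_add smooth_on_mult smooth_on_const S sm)
      (use abs_less_one_sq[OF b] in \<open>simp add: power2_eq_square\<close>)
  have ad: "smooth_on S (\<lambda>u. (pi / d) * a u)"
    by (intro smooth_on_mult smooth_on_const S sm)
  have "(\<lambda>u. polar d (a u, R (cyl (b u) (c u)))) =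
     (\<lambda>u. cos ((pi / d) * a u) *\<^sub>R (1, 0)
        + sin ((pi / d) * a u) *\<^sub>R ((sqrt (1 + (- 1) * (b u * b u)) * cos (c u)) *\<^sub>R (0, R (axis 1 1))
        + (sqrt (1 + (- 1) * (b u * b u)) * sin (c u)) *\<^sub>R (0, R (axis 2 1)) + b u *\<^sub>R (0, R (axis 3 1))))"
    by (simp add: polar_def cyl_def linear_add[OF R] linear_cmul[OF R] power2_eq_square fun_eq_iff)
  moreover have "smooth_on S \<dots>"
    by (intro smooth_on_add smooth_on_scaleR smooth_on_mult smooth_on_const smooth_on_sin smooth_on_cos
        S sm sq ad)
  ultimately show ?thesis by simp
qed

section \<open>Charts as local parametrizations\<close>

text \<open>The half plane over the meridian \<open>p = \<pi>\<close>, which the angle coordinate in \<open>(-\<pi>, \<pi>)\<close> leaves out. It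
contains the axis through the poles of the two-sphere.\<close>

definition slit :: "(real^3) set" where
  "slit = {w. w $ 2 = 0 \<and> w $ 1 \<le> 0}"

lemma closed_slit: "closed slit"
  unfolding slit_def by (intro closed_Collect_conj closed_Collect_eq closed_Collect_le continuous_intros)

lemma cyl_notin_slit:
  assumes "\<bar>z\<bar> < 1" "\<bar>p\<bar> < pi"
  shows "cyl z p \<notin> slit"
proof
  assume a: "cyl z p \<in> slit"
  have r: "sqrt (1 - z\<^sup>2) > 0" using abs_less_one_sq[OF assms(1)] by simp
  have "sin p = 0" using a r by (auto simp: slit_def)
  then have "p = 0" using assms(2) sin_eq_0_pi[of p] by (simp add: abs_less_iff)
  with a r show False by (simp add: slit_def)
qed

lemma Arg_cyl:
  assumes "\<bar>z\<bar> < 1" "\<bar>p\<bar> < pi"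
  shows "Arg (Complex (cyl z p $ 1) (cyl z p $ 2)) = p"
proof (rule Arg_unique)
  show "0 < sqrt (1 - z\<^sup>2)" using abs_less_one_sq[OF assms(1)] by simp
  show "of_real (sqrt (1 - z\<^sup>2)) * exp (\<i> * of_real p) = Complex (cyl z p $ 1) (cyl z p $ 2)"
    by (simp add: complex_eq_iff cis_conv_exp[symmetric])
qed (use assms in auto)

lemma cyl_Arg:
  fixes w :: "real^3"
  assumes "norm w = 1" "w \<notin> slit"
  shows "\<bar>w $ 3\<bar> < 1" "\<bar>Arg (Complex (w $ 1) (w $ 2))\<bar> < pi"
    "cyl (w $ 3) (Arg (Complex (w $ 1) (w $ 2))) = w"
proof -
  define \<zeta> where "\<zeta> = Complex (w $ 1) (w $ 2)"
  have z: "\<zeta> \<noteq> 0" using assms(2) by (auto simp: slit_def \<zeta>_def complex_eq_iff)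
  have "w \<bullet> w = 1" using assms(1) by (simp add: norm_eq_1)
  then have "(w $ 1)\<^sup>2 + (w $ 2)\<^sup>2 + (w $ 3)\<^sup>2 = 1"
    by (simp add: inner_real3 power2_eq_square)
  then have n: "(norm \<zeta>)\<^sup>2 = 1 - (w $ 3)\<^sup>2"
    by (simp add: cmod_power2 \<zeta>_def)
  then have nn: "norm \<zeta> = sqrt (1 - (w $ 3)\<^sup>2)" by (metis norm_ge_zero real_sqrt_unique)
  have "0 < (norm \<zeta>)\<^sup>2" using z by simp
  then show w3: "\<bar>w $ 3\<bar> < 1" using n by (simp add: abs_square_less_1)
  have "Arg \<zeta> \<noteq> pi"
    using assms(2) Arg_eq_pi[of \<zeta>] by (auto simp: slit_def \<zeta>_def)
  then show "\<bar>Arg (Complex (w $ 1) (w $ 2))\<bar> < pi"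
    using Arg_bounded[of \<zeta>] by (auto simp: \<zeta>_def)
  have "\<zeta> = of_real (norm \<zeta>) * exp (\<i> * of_real (Arg \<zeta>))"
    using Arg_eq[OF z] by simp
  then have "\<zeta> = of_real (norm \<zeta>) * cis (Arg \<zeta>)" by (simp add: cis_conv_exp)
  then have "w $ 1 = norm \<zeta> * cos (Arg \<zeta>)" "w $ 2 = norm \<zeta> * sin (Arg \<zeta>)"
    unfolding \<zeta>_def complex_eq_iff by simp_all
  then have "cyl (w $ 3) (Arg \<zeta>) = w"
    using nn by (simp add: vec_eq_iff forall_3)
  then show "cyl (w $ 3) (Arg (Complex (w $ 1) (w $ 2))) = w" by (simp add: \<zeta>_def)
qed

definition chart_inv :: "real \<Rightarrow> (real^3 \<Rightarrow> real^3) \<Rightarrow> pt \<Rightarrow> real^3" where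
  "chart_inv d R q = (let w = R (snd q /\<^sub>R norm (snd q)) in
     (d / pi * arccos (fst q)) *\<^sub>R axis 1 1 + (w $ 3) *\<^sub>R axis 2 1 + Arg (Complex (w $ 1) (w $ 2)) *\<^sub>R axis 3 1)"

lemma chart_inv_nth [simp]:
  "chart_inv d R q $ 1 = d / pi * arccos (fst q)"
  "chart_inv d R q $ 2 = R (snd q /\<^sub>R norm (snd q)) $ 3"
  "chart_inv d R q $ 3 = Arg (Complex (R (snd q /\<^sub>R norm (snd q)) $ 1) (R (snd q /\<^sub>R norm (snd q)) $ 2))"
  by (simp_all add: chart_inv_def Let_def axis_def)

definition chart_image :: "(real^3 \<Rightarrow> real^3) \<Rightarrow> pt set" where
  "chart_image R = {q \<in> S3. R (snd q) \<notin> slit}"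

lemma S3_iff: "q \<in> S3 \<longleftrightarrow> (fst q)\<^sup>2 + (norm (snd q))\<^sup>2 = 1"
  by (simp add: S3_def norm_prod_def)

lemma slit_scale: "0 < c \<Longrightarrow> c *\<^sub>R w \<in> slit \<longleftrightarrow> w \<in> slit"
  by (auto simp: slit_def zero_le_mult_iff mult_le_0_iff)

lemma zero_in_slit [simp]: "0 \<in> slit"
  by (simp add: slit_def)

lemma open_chart_dom: "open (chart_dom d)"
  unfolding chart_dom_def by (intro open_Collect_conj open_Collect_less continuous_intros)

text \<open>Both turns of the two-sphere used below are involutions, so the same map \<open>R\<close> describes the inverse
chart.\<close>

locale chart_frame =
  fixes d :: real and R :: "real^3 \<Rightarrow> real^3"
  assumes d: "0 < d" and R: "orthogonal_transformation R" and RR: "R (R x) = x"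
begin

lemma lin: "linear R" and norm_R [simp]: "norm (R x) = norm x" and R0 [simp]: "R 0 = 0"
  using R by (auto simp: orthogonal_transformation_def orthogonal_transformation_norm linear_0)

lemma polar_in_S3: "norm w = 1 \<Longrightarrow> polar d (s, w) \<in> S3"
  by (simp add: S3_iff polar_def)

lemma sin_pos: "0 < s \<Longrightarrow> s < d \<Longrightarrow> 0 < sin (pi * s / d)"
  using d by (intro sin_gt_zero) (auto simp: field_simps)

lemma chart_in: "u \<in> chart_dom d \<Longrightarrow> chart d R u \<in> chart_image R"
proof -
  assume u: "u \<in> chart_dom d"
  have "chart d R u \<in> S3" unfolding chart_def
    using u by (intro polar_in_S3) (simp add: chart_dom_def norm_cyl)
  moreover have "R (snd (chart d R u)) = sin (pi * u $ 1 / d) *\<^sub>R cyl (u $ 2) (u $ 3)"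
    by (simp add: chart_def polar_def linear_cmul[OF lin] RR)
  ultimately show ?thesis
    using u by (simp add: chart_image_def slit_scale sin_pos chart_dom_def cyl_notin_slit)
qed

lemma chart_inv_chart: "u \<in> chart_dom d \<Longrightarrow> chart_inv d R (chart d R u) = u"
proof -
  assume u: "u \<in> chart_dom d"
  let ?w = "cyl (u $ 2) (u $ 3)" and ?s = "sin (pi * u $ 1 / d)"
  have s: "0 < ?s" using u by (simp add: chart_dom_def sin_pos)
  have w: "norm ?w = 1" using u by (simp add: chart_dom_def norm_cyl)
  have 1: "snd (chart d R u) = ?s *\<^sub>R R ?w" "fst (chart d R u) = cos (pi * u $ 1 / d)"
    by (simp_all add: chart_def polar_def)
  have 2: "R (snd (chart d R u) /\<^sub>R norm (snd (chart d R u))) = ?w"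
    using s w by (simp add: 1 linear_cmul[OF lin] RR)
  have "arccos (cos (pi * u $ 1 / d)) = pi * u $ 1 / d"
    using u d by (intro arccos_cos) (auto simp: chart_dom_def field_simps)
  then have "chart_inv d R (chart d R u) $ 1 = u $ 1" using d by (simp add: 1)
  moreover have "chart_inv d R (chart d R u) $ 2 = u $ 2" "chart_inv d R (chart d R u) $ 3 = u $ 3"
    using u unfolding chart_inv_nth 2 by (simp_all add: Arg_cyl chart_dom_def del: cyl_nth(1,2))
  ultimately show ?thesis by (simp only: vec_eq_iff forall_3)
qed

lemma
  assumes q: "q \<in> chart_image R"
  shows chart_inv_in: "chart_inv d R q \<in> chart_dom d" and chart_chart_inv: "chart d R (chart_inv d R q) = q"
proof -
  define y n where "y = snd q" and "n = norm y"
  define w where "w = R (y /\<^sub>R n)"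
  have S: "(fst q)\<^sup>2 + n\<^sup>2 = 1" and y: "R y \<notin> slit"
    using q by (auto simp: chart_image_def S3_iff y_def n_def)
  then have "y \<noteq> 0" using zero_in_slit R0 by metis
  then have n: "0 < n" by (simp add: n_def)
  then have w1: "norm w = 1" by (simp add: w_def n_def)
  have "w \<notin> slit" using y n by (simp add: w_def linear_cmul[OF lin] slit_scale)
  note w = cyl_Arg[OF w1 this]
  have "(fst q)\<^sup>2 < 1" using S n zero_less_power[OF n, of 2] by linarith
  then have c: "\<bar>fst q\<bar> < 1" by (simp add: abs_square_less_1)
  then have a: "0 < arccos (fst q)" "arccos (fst q) < pi"
    using arccos_lt_bounded[of "fst q"] by auto
  show "chart_inv d R q \<in> chart_dom d"
    using w a d by (simp add: chart_dom_def w_def y_def n_def field_simps)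
  have "sin (arccos (fst q)) = sqrt (1 - (fst q)\<^sup>2)" using c by (intro sin_arccos) auto
  also have "\<dots> = n" using S n by (intro real_sqrt_unique) auto
  finally have "sin (arccos (fst q)) = n" .
  moreover have "cos (arccos (fst q)) = fst q" using c by (intro cos_arccos) auto
  moreover have "cyl (chart_inv d R q $ 2) (chart_inv d R q $ 3) = w"
    using w(3) by (simp add: w_def y_def n_def)
  ultimately have "chart d R (chart_inv d R q) = (fst q, n *\<^sub>R R w)"
    using d by (simp add: chart_def polar_def)
  also have "n *\<^sub>R R w = y" using n by (simp add: w_def RR)
  finally show "chart d R (chart_inv d R q) = q" by (simp add: y_def)
qed

lemma smooth_chart: "smooth_on (chart_dom d) (chart d R)"
proof -
  have nth: "smooth_on (chart_dom d) (\<lambda>u. u $ i)" for i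
    by (rule smooth_on_linear[OF open_chart_dom bounded_linear_vec_nth])
  have "smooth_on (chart_dom d) (\<lambda>u. polar d (u $ 1, R (cyl (u $ 2) (u $ 3))))"
    by (rule smooth_on_polar_cyl[OF open_chart_dom lin nth nth nth]) (simp add: chart_dom_def)
  moreover have "chart d R = (\<lambda>u. polar d (u $ 1, R (cyl (u $ 2) (u $ 3))))"
    by (simp add: chart_def fun_eq_iff)
  ultimately show ?thesis by simp
qed

text \<open>The principal argument is continuous off the nonpositive real axis, which is where the first two
coordinates of the points of \<open>slit\<close> lie.\<close>

lemma continuous_chart_inv: "continuous_on (chart_image R) (chart_inv d R)"
proof -
  define w where "w q = R (snd q /\<^sub>R norm (snd q))" for q :: pt
  have nz: "snd q \<noteq> 0" if "q \<in> chart_image R" for q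
    using that zero_in_slit R0 by (auto simp: chart_image_def)
  have cw: "continuous_on (chart_image R) w"
    unfolding w_def
    by (rule continuous_on_compose2[OF linear_continuous_on[OF linear_conv_bounded_linear[THEN iffD1, OF lin]] _ subset_UNIV])
      (use nz in \<open>auto intro!: continuous_intros\<close>)
  have ca: "continuous_on (chart_image R) (\<lambda>q. Arg (Complex (w q $ 1) (w q $ 2)))"
  proof (rule continuous_on_compose2[of "- \<real>\<^sub>\<le>\<^sub>0" Arg])
    show "continuous_on (- \<real>\<^sub>\<le>\<^sub>0) Arg"
      by (auto intro!: continuous_at_imp_continuous_on continuous_at_Arg)
    show "continuous_on (chart_image R) (\<lambda>q. Complex (w q $ 1) (w q $ 2))"
      unfolding Complex_eq by (intro continuous_intros cw)
    have "w q \<notin> slit" if "q \<in> chart_image R" for q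
      using that nz[OF that] by (simp add: w_def linear_cmul[OF lin] slit_scale chart_image_def)
    then show "(\<lambda>q. Complex (w q $ 1) (w q $ 2)) ` chart_image R \<subseteq> - \<real>\<^sub>\<le>\<^sub>0"
      by (auto simp: slit_def complex_nonpos_Reals_iff)
  qed
  have "\<bar>fst q\<bar> \<le> 1" if "q \<in> S3" for q
  proof -
    have "(fst q)\<^sup>2 \<le> 1" using that zero_le_power2[of "norm (snd q)"] unfolding S3_iff by linarith
    then show ?thesis by (simp add: abs_square_le_1)
  qed
  then have cc: "continuous_on (chart_image R) (\<lambda>q. arccos (fst q))"
    by (intro continuous_on_arccos continuous_intros) (auto simp: chart_image_def abs_le_iff minus_le_iff)
  show ?thesis
    unfolding chart_inv_def Let_def w_def[symmetric]
    by (intro continuous_intros cc ca cw)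
qed

lemma chart_homeomorphism: "homeomorphism (chart_dom d) (chart_image R) (chart d R) (chart_inv d R)"
proof (rule homeomorphismI)
  show "continuous_on (chart_dom d) (chart d R)"
    using smooth_chart unfolding smooth_on_def by (metis Ck_on.simps(1))
  show "continuous_on (chart_image R) (chart_inv d R)" by (rule continuous_chart_inv)
qed (use chart_in chart_inv_in chart_chart_inv chart_inv_chart in blast)+

lemma openin_chart_image: "openin (top_of_set S3) (chart_image R)"
proof -
  have "open (- ((\<lambda>q::pt. R (snd q)) -` slit))"
    by (intro open_Compl closed_vimage[OF closed_slit] linear_continuous_on_compose[OF _ lin]
        continuous_on_snd continuous_on_id)
  moreover have "chart_image R = S3 \<inter> - ((\<lambda>q::pt. R (snd q)) -` slit)"
    by (auto simp: chart_image_def)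
  ultimately show ?thesis by (metis openin_open)
qed

end

section \<open>Parametrizing the latitude spheres\<close>

lemma pullback_comp:
  assumes "Y differentiable (at u)" "\<phi> differentiable (at (Y u))"
  shows "pullback g (\<phi> \<circ> Y) u v w = pullback (pullback g \<phi>) Y u v w"
  using assms by (simp add: pullback_def frechet_derivative_compose)

lemma smooth_on_differentiable:
  assumes "open S" "smooth_on S f" "u \<in> S" shows "f differentiable (at u)"
proof -
  have "Ck_on (Suc 0) S f" using assms(2) unfolding smooth_on_def by (rule spec)
  then have "f differentiable_on S" unfolding Ck_on.simps by (rule conjunct1)
  then have "f differentiable (at u within S)" using assms(3) unfolding differentiable_on_def by (rule bspec)
  then show ?thesis using at_within_open[OF assms(3,1)] by metis
qed

definition slice :: "real \<Rightarrow> real \<Rightarrow> pt set" where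
  "slice d s = {q \<in> S3. fst q = cos (pi * s / d)}"

text \<open>In the chart, a latitude sphere is the plane of points with first coordinate \<open>s\<close>.\<close>

definition slice_emb :: "real \<Rightarrow> real^2 \<Rightarrow> real^3" where
  "slice_emb s u = s *\<^sub>R axis 1 1 + (u $ 1) *\<^sub>R axis 2 1 + (u $ 2) *\<^sub>R axis 3 1"

definition slice_dom :: "(real^2) set" where
  "slice_dom = {u. \<bar>u $ 1\<bar> < 1 \<and> \<bar>u $ 2\<bar> < pi}"

lemma slice_emb_nth [simp]:
  "slice_emb s u $ 1 = s" "slice_emb s u $ 2 = u $ 1" "slice_emb s u $ 3 = u $ 2"
  by (simp_all add: slice_emb_def axis_def)

lemma slice_emb_has_derivative:
  "(slice_emb s has_derivative (\<lambda>v. (v $ 1) *\<^sub>R axis 2 1 + (v $ 2) *\<^sub>R axis 3 1)) (at u)"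
proof -
  have nth: "((\<lambda>u::real^2. u $ i) has_derivative (\<lambda>v. v $ i)) (at u)" for i
    by (rule bounded_linear_imp_has_derivative[OF bounded_linear_vec_nth])
  have "((\<lambda>u::real^2. s *\<^sub>R axis 1 1 + (u $ 1) *\<^sub>R axis 2 1 + (u $ 2) *\<^sub>R axis 3 1 :: real^3) has_derivative
      (\<lambda>v. (v $ 1) *\<^sub>R axis 2 1 + (v $ 2) *\<^sub>R axis 3 1)) (at u)"
    by (auto intro!: derivative_eq_intros nth)
  moreover have "slice_emb s = (\<lambda>u. s *\<^sub>R axis 1 1 + (u $ 1) *\<^sub>R axis 2 1 + (u $ 2) *\<^sub>R axis 3 1)"
    by (simp add: slice_emb_def fun_eq_iff)
  ultimately show ?thesis by simp
qed

lemma slice_emb_frechet: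
  "frechet_derivative (slice_emb s) (at u) = (\<lambda>v. (v $ 1) *\<^sub>R axis 2 1 + (v $ 2) *\<^sub>R axis 3 1)"
  by (rule frechet_derivative_at[OF slice_emb_has_derivative, symmetric])

lemma open_slice_dom: "open slice_dom"
  unfolding slice_dom_def by (intro open_Collect_conj open_Collect_less continuous_intros)

lemma smooth_slice_emb: "open V \<Longrightarrow> smooth_on V (slice_emb s)"
proof -
  assume V: "open V"
  have "smooth_on V (\<lambda>u::real^2. s *\<^sub>R axis 1 1 + (u $ 1) *\<^sub>R axis 2 1 + (u $ 2) *\<^sub>R axis 3 1 :: real^3)"
    by (intro smooth_on_add smooth_on_scaleR smooth_on_const smooth_on_linear bounded_linear_vec_nth V)
  moreover have "slice_emb s = (\<lambda>u. s *\<^sub>R axis 1 1 + (u $ 1) *\<^sub>R axis 2 1 + (u $ 2) *\<^sub>R axis 3 1)"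
    by (simp add: slice_emb_def fun_eq_iff)
  ultimately show ?thesis by simp
qed

locale rot_chart = chart_frame +
  fixes g :: "pt tensor2" and f :: "real \<Rightarrow> real"
  assumes rot: "rot_symmetric g d f"
begin

lemma f_pos: "0 < s \<Longrightarrow> s < d \<Longrightarrow> 0 < f s"
  using rot unfolding rot_symmetric_def by (elim conjE) simp

lemma g_bilinear: "p \<in> S3 \<Longrightarrow> bilinear (g p)"
  using rot unfolding rot_symmetric_def riemannian_metric_def by (elim conjE) simp

lemma chart_differentiable: "u \<in> chart_dom d \<Longrightarrow> chart d R differentiable (at u)"
  by (rule smooth_on_differentiable[OF open_chart_dom smooth_chart])

lemma chart_image_eq: "chart d R ` chart_dom d = chart_image R"
  using chart_homeomorphism by (rule homeomorphism_image1)

text \<open>The pulled back metric is positive definite, so no nonzero vector is sent to zero.\<close>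

lemma chart_inj:
  assumes u: "u \<in> chart_dom d"
  shows "inj (frechet_derivative (chart d R) (at u))"
proof -
  let ?D = "frechet_derivative (chart d R) (at u)"
  have lin: "linear ?D" by (rule linear_frechet_derivative[OF chart_differentiable[OF u]])
  have "v = 0" if "?D v = 0" for v
  proof -
    have "chart d R u \<in> S3" using chart_in[OF u] by (simp add: chart_image_def)
    then have "pullback g (chart d R) u v v = 0"
      using bilinear_lzero[OF g_bilinear] by (simp add: pullback_def that)
    then have 0: "v $ 1 * v $ 1 + (f (u $ 1))\<^sup>2 * (v $ 2 * v $ 2 / (1 - (u $ 2)\<^sup>2) + v $ 3 * v $ 3 * (1 - (u $ 2)\<^sup>2)) = 0"
      by (simp add: pullback_chart[OF rot R u])
    have F: "(f (u $ 1))\<^sup>2 > 0" using f_pos[of "u $ 1"] u by (simp add: chart_dom_def)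
    have z: "1 - (u $ 2)\<^sup>2 > 0" using abs_less_one_sq[of "u $ 2"] u by (simp add: chart_dom_def)
    have a: "0 \<le> v $ 2 * v $ 2 / (1 - (u $ 2)\<^sup>2)" "0 \<le> v $ 3 * v $ 3 * (1 - (u $ 2)\<^sup>2)"
      using z by simp_all
    then have b: "0 \<le> (f (u $ 1))\<^sup>2 * (v $ 2 * v $ 2 / (1 - (u $ 2)\<^sup>2) + v $ 3 * v $ 3 * (1 - (u $ 2)\<^sup>2))"
      by (rule mult_nonneg_nonneg[OF zero_le_power2 add_nonneg_nonneg])
    then have "v $ 1 * v $ 1 = 0" and
      "(f (u $ 1))\<^sup>2 * (v $ 2 * v $ 2 / (1 - (u $ 2)\<^sup>2) + v $ 3 * v $ 3 * (1 - (u $ 2)\<^sup>2)) = 0"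
      using 0 add_nonneg_eq_0_iff[OF zero_le_square b] by auto
    then have "v $ 2 * v $ 2 / (1 - (u $ 2)\<^sup>2) + v $ 3 * v $ 3 * (1 - (u $ 2)\<^sup>2) = 0" using F by simp
    then have "v $ 2 * v $ 2 / (1 - (u $ 2)\<^sup>2) = 0" "v $ 3 * v $ 3 * (1 - (u $ 2)\<^sup>2) = 0"
      using add_nonneg_eq_0_iff[OF a] by auto
    with \<open>v $ 1 * v $ 1 = 0\<close> z show "v = 0" by (simp add: vec_eq_iff forall_3)
  qed
  then show ?thesis using lin linear_injective_0 by blast
qed

lemma local_param_chart: "local_param S3 (chart_dom d) (chart d R)"
  unfolding local_param_def chart_image_eq
  using open_chart_dom smooth_chart chart_inj openin_chart_image chart_homeomorphism by blast

lemma slice_emb_in: "0 < s \<Longrightarrow> s < d \<Longrightarrow> slice_emb s u \<in> chart_dom d \<longleftrightarrow> u \<in> slice_dom"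
  by (simp add: chart_dom_def slice_dom_def)

definition slice_param :: "real \<Rightarrow> real^2 \<Rightarrow> pt" where
  "slice_param s = chart d R \<circ> slice_emb s"

lemma slice_param_in:
  assumes "0 < s" "s < d" "u \<in> slice_dom"
  shows "slice_param s u \<in> slice d s \<inter> chart_image R"
  using chart_in[of "slice_emb s u"] slice_emb_in[OF assms(1,2)] assms(3)
  by (simp add: slice_param_def slice_def chart_image_def) (simp add: chart_def polar_def)

lemma slice_param_frechet:
  assumes "0 < s" "s < d" "u \<in> slice_dom"
  shows "frechet_derivative (slice_param s) (at u) =
    frechet_derivative (chart d R) (at (slice_emb s u)) \<circ> frechet_derivative (slice_emb s) (at u)"
  unfolding slice_param_def
  using slice_emb_has_derivative chart_differentiable[of "slice_emb s u"] slice_emb_in[OF assms(1,2)] assms(3)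
  by (intro frechet_derivative_compose) (auto intro: differentiableI)

definition slice_inv :: "pt \<Rightarrow> real^2" where
  "slice_inv q = (chart_inv d R q $ 2) *\<^sub>R axis 1 1 + (chart_inv d R q $ 3) *\<^sub>R axis 2 1"

lemma slice_inv_nth: "slice_inv q $ 1 = chart_inv d R q $ 2" "slice_inv q $ 2 = chart_inv d R q $ 3"
  by (simp_all add: slice_inv_def axis_def)

lemma slice_inv_slice_param:
  assumes "0 < s" "s < d" "u \<in> slice_dom"
  shows "slice_inv (slice_param s u) = u"
  using chart_inv_chart[of "slice_emb s u"] slice_emb_in[OF assms(1,2)] assms(3)
  by (simp add: vec_eq_iff forall_2 slice_inv_nth slice_param_def del: chart_inv_nth)

lemma
  assumes s: "0 < s" "s < d" and q: "q \<in> slice d s \<inter> chart_image R"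
  shows slice_param_slice_inv: "slice_param s (slice_inv q) = q"
    and slice_inv_in: "slice_inv q \<in> slice_dom"
proof -
  have "arccos (cos (pi * s / d)) = pi * s / d"
    using s by (intro arccos_cos) (auto simp: field_simps)
  then have "chart_inv d R q $ 1 = s" using q d by (simp add: slice_def)
  then have e: "slice_emb s (slice_inv q) = chart_inv d R q"
    by (simp add: vec_eq_iff forall_3 slice_inv_nth del: chart_inv_nth)
  show "slice_param s (slice_inv q) = q"
    using chart_chart_inv[of q] q by (simp add: slice_param_def e)
  show "slice_inv q \<in> slice_dom"
    using chart_inv_in[of q] q slice_emb_in[OF s, of "slice_inv q"] by (simp add: e)
qed

lemma slice_param_image:
  assumes s: "0 < s" "s < d" shows "slice_param s ` slice_dom = slice d s \<inter> chart_image R"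
proof
  show "slice_param s ` slice_dom \<subseteq> slice d s \<inter> chart_image R"
    using slice_param_in[OF s] by blast
  show "slice d s \<inter> chart_image R \<subseteq> slice_param s ` slice_dom"
    using slice_param_slice_inv[OF s] slice_inv_in[OF s] by (metis imageI subsetI)
qed

lemma smooth_slice_param: "smooth_on slice_dom (slice_param s)"
proof -
  have nth: "smooth_on slice_dom (\<lambda>u. u $ i)" for i
    by (rule smooth_on_linear[OF open_slice_dom bounded_linear_vec_nth])
  have "smooth_on slice_dom (\<lambda>u. polar d (s, R (cyl (u $ 1) (u $ 2))))"
    by (rule smooth_on_polar_cyl[OF open_slice_dom lin smooth_on_const[OF open_slice_dom] nth nth])
      (simp add: slice_dom_def)
  moreover have "slice_param s = (\<lambda>u. polar d (s, R (cyl (u $ 1) (u $ 2))))"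
    by (simp add: slice_param_def chart_def fun_eq_iff)
  ultimately show ?thesis by simp
qed

lemma local_param_slice:
  assumes s: "0 < s" "s < d"
  shows "local_param (slice d s) slice_dom (slice_param s)"
proof -
  have "homeomorphism slice_dom (slice d s \<inter> chart_image R) (slice_param s) slice_inv"
  proof (rule homeomorphismI)
    have "Ck_on 0 slice_dom (slice_param s)" using smooth_slice_param unfolding smooth_on_def by (rule spec)
    then show "continuous_on slice_dom (slice_param s)" unfolding Ck_on.simps .
    have c: "continuous_on (slice d s \<inter> chart_image R) (chart_inv d R)"
      using continuous_chart_inv by (rule continuous_on_subset) simp
    have "continuous_on (slice d s \<inter> chart_image R)
        (\<lambda>q. (chart_inv d R q $ 2) *\<^sub>R axis 1 1 + (chart_inv d R q $ 3) *\<^sub>R axis 2 1 :: real^2)"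
      by (intro continuous_intros c)
    then show "continuous_on (slice d s \<inter> chart_image R) slice_inv"
      by (simp add: slice_inv_def[abs_def])
  qed (use slice_inv_slice_param[OF s] slice_param_slice_inv[OF s] slice_inv_in[OF s] slice_param_in[OF s] in blast)+
  moreover have "inj (frechet_derivative (slice_param s) (at u))" if u: "u \<in> slice_dom" for u
  proof -
    have "inj (\<lambda>v::real^2. (v $ 1) *\<^sub>R axis 2 1 + (v $ 2) *\<^sub>R axis 3 1 :: real^3)"
      by (rule injI) (simp add: vec_eq_iff forall_3 forall_2 axis_def)
    then show ?thesis
      unfolding slice_param_frechet[OF s u] slice_emb_frechet
      using chart_inj[of "slice_emb s u"] slice_emb_in[OF s] u by (intro inj_compose) auto
  qed
  moreover have "openin (top_of_set (slice d s)) (slice d s \<inter> chart_image R)"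
  proof -
    obtain T where "open T" "chart_image R = S3 \<inter> T" using openin_chart_image by (auto simp: openin_open)
    then show ?thesis by (auto simp: openin_open slice_def)
  qed
  ultimately show ?thesis
    unfolding local_param_def slice_param_image[OF s] using open_slice_dom smooth_slice_param by blast
qed

end

section \<open>Curvature in the cylindrical chart\<close>

definition diag3 :: "real \<Rightarrow> real \<Rightarrow> real^3^3" where
  "diag3 P Q = (\<chi> i j. if i = j then (if i = 1 then 1 else if i = 2 then P else Q) else 0)"

lemma matrix_inv_eqI:
  fixes A B :: "real^'n^'n"
  assumes "A ** B = mat 1" "B ** A = mat 1" shows "matrix_inv A = B"
proof -
  have "A ** matrix_inv A = mat 1 \<and> matrix_inv A ** A = mat 1"
    unfolding matrix_inv_def by (rule someI[of _ B]) (use assms in simp)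
  then show ?thesis by (metis assms(2) matrix_mul_assoc matrix_mul_lid matrix_mul_rid)
qed

lemma matrix_inv_diag3:
  assumes "P \<noteq> 0" "Q \<noteq> 0" shows "matrix_inv (diag3 P Q) = diag3 (1 / P) (1 / Q)"
  by (rule matrix_inv_eqI)
    (use assms in \<open>simp_all add: vec_eq_iff forall_3 diag3_def matrix_matrix_mult_def mat_def sum_3\<close>)

text \<open>Only the values of \<open>h\<close> near \<open>u\<close> matter, and inside the chart they are given by explicit formulas.\<close>

lemma pd_eqI:
  assumes "open U" "u \<in> U" "\<And>x. x \<in> U \<Longrightarrow> h x = H x" "(H has_derivative D) (at u)"
  shows "pd i h u = D (axis i 1)"
proof -
  have "(h has_derivative D) (at u)"
    by (rule has_derivative_transform_within_open[OF assms(4,1,2)]) (simp add: assms(3))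
  then show ?thesis by (simp add: pd_def frechet_derivative_at[symmetric])
qed

lemma pd_const: "open U \<Longrightarrow> u \<in> U \<Longrightarrow> (\<And>x. x \<in> U \<Longrightarrow> h x = c) \<Longrightarrow> pd i h u = 0"
  by (rule pd_eqI[where D = "\<lambda>_. 0", OF _ _ _ has_derivative_const])

lemma vec_nth_has_derivative: "((\<lambda>u::real^'n. u $ i) has_derivative (\<lambda>v. v $ i)) (at u)"
  by (rule bounded_linear_imp_has_derivative[OF bounded_linear_vec_nth])

text \<open>The Christoffel symbols \<open>\<Gamma>\<^sup>k\<^sub>i\<^sub>j\<close> of the diagonal metric with entries \<open>1\<close>, \<open>F\<^sup>2/(1 - z\<^sup>2)\<close>,
\<open>F\<^sup>2 (1 - z\<^sup>2)\<close>, where \<open>F\<close> and \<open>G\<close> stand for the values of \<open>f\<close> and \<open>f'\<close>.\<close>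

definition chart_christoffel :: "real \<Rightarrow> real \<Rightarrow> real \<Rightarrow> 3 \<Rightarrow> 3 \<Rightarrow> 3 \<Rightarrow> real" where
  "chart_christoffel F G z k i j =
    (if k = 1 then (if i = 2 \<and> j = 2 then - F * G / (1 - z\<^sup>2) else if i = 3 \<and> j = 3 then - F * G * (1 - z\<^sup>2) else 0)
     else if k = 2 then (if i = 1 \<and> j = 2 \<or> i = 2 \<and> j = 1 then G / F
       else if i = 2 \<and> j = 2 then z / (1 - z\<^sup>2) else if i = 3 \<and> j = 3 then z * (1 - z\<^sup>2) else 0)
     else (if i = 1 \<and> j = 3 \<or> i = 3 \<and> j = 1 then G / F
       else if i = 2 \<and> j = 3 \<or> i = 3 \<and> j = 2 then - z / (1 - z\<^sup>2) else 0))"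

context rot_chart
begin

lemma tensor_matrix_chart:
  assumes "u \<in> chart_dom d"
  shows "tensor_matrix (pullback g (chart d R)) u
    = diag3 ((f (u $ 1))\<^sup>2 / (1 - (u $ 2)\<^sup>2)) ((f (u $ 1))\<^sup>2 * (1 - (u $ 2)\<^sup>2))"
  unfolding tensor_matrix_def diag3_def pullback_chart[OF rot R assms]
  by (simp add: vec_eq_iff forall_3 axis_def)

context
  fixes f' :: "real \<Rightarrow> real"
  assumes f': "\<And>s. 0 < s \<Longrightarrow> s < d \<Longrightarrow> (f has_real_derivative f' s) (at s)"
begin

lemma f_vec_has_derivative:
  assumes "u \<in> chart_dom d"
  shows "((\<lambda>x. f (x $ 1)) has_derivative (\<lambda>v. f' (u $ 1) * v $ 1)) (at u)"
proof -
  have "(f has_real_derivative f' (u $ 1)) (at (u $ 1))"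
    using assms by (intro f') (simp_all add: chart_dom_def)
  from has_derivative_compose[OF vec_nth_has_derivative this[unfolded has_field_derivative_def]]
  show ?thesis .
qed

lemma pd_metric:
  assumes u: "u \<in> chart_dom d"
  shows "pd i (\<lambda>x. tensor_matrix (pullback g (chart d R)) x $ j $ l) u =
    (if j = l \<and> j = 2 then
       (if i = 1 then 2 * f (u $ 1) * f' (u $ 1) / (1 - (u $ 2)\<^sup>2)
        else if i = 2 then 2 * (u $ 2) * (f (u $ 1))\<^sup>2 / (1 - (u $ 2)\<^sup>2)\<^sup>2 else 0)
     else if j = l \<and> j = 3 then
       (if i = 1 then 2 * f (u $ 1) * f' (u $ 1) * (1 - (u $ 2)\<^sup>2)
        else if i = 2 then - 2 * (u $ 2) * (f (u $ 1))\<^sup>2 else 0)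
     else 0)"
proof -
  let ?m = "\<lambda>j l x. tensor_matrix (pullback g (chart d R)) x $ j $ l"
  have nz: "1 - (u $ 2)\<^sup>2 \<noteq> 0" using abs_less_one_sq[of "u $ 2"] u by (simp add: chart_dom_def)
  have off: "pd i (?m j l) u = 0" if "j \<noteq> l \<or> j = 1" for j l
    by (rule pd_const[OF open_chart_dom u, where c = "if j = l then 1 else 0"])
      (use that in \<open>auto simp: tensor_matrix_chart diag3_def\<close>)
  have m2: "pd i (?m 2 2) u = (\<lambda>v. 2 * f (u $ 1) * f' (u $ 1) * v $ 1 / (1 - (u $ 2)\<^sup>2)
      + 2 * (u $ 2) * (f (u $ 1))\<^sup>2 * v $ 2 / (1 - (u $ 2)\<^sup>2)\<^sup>2) (axis i 1)"
  proof (rule pd_eqI[OF open_chart_dom u])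
    show "?m 2 2 x = (f (x $ 1))\<^sup>2 / (1 - (x $ 2)\<^sup>2)" if "x \<in> chart_dom d" for x
      by (simp add: tensor_matrix_chart[OF that] diag3_def)
    show "((\<lambda>x. (f (x $ 1))\<^sup>2 / (1 - (x $ 2)\<^sup>2)) has_derivative
      (\<lambda>v. 2 * f (u $ 1) * f' (u $ 1) * v $ 1 / (1 - (u $ 2)\<^sup>2)
      + 2 * (u $ 2) * (f (u $ 1))\<^sup>2 * v $ 2 / (1 - (u $ 2)\<^sup>2)\<^sup>2)) (at u)"
      by (rule has_derivative_eq_rhs, (rule derivative_intros f_vec_has_derivative[OF u] vec_nth_has_derivative nz)+)
        (use nz in \<open>simp add: fun_eq_iff field_simps power2_eq_square\<close>)
  qed
  have m3: "pd i (?m 3 3) u = (\<lambda>v. 2 * f (u $ 1) * f' (u $ 1) * v $ 1 * (1 - (u $ 2)\<^sup>2)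
      - 2 * (u $ 2) * (f (u $ 1))\<^sup>2 * v $ 2) (axis i 1)"
  proof (rule pd_eqI[OF open_chart_dom u])
    show "?m 3 3 x = (f (x $ 1))\<^sup>2 * (1 - (x $ 2)\<^sup>2)" if "x \<in> chart_dom d" for x
      by (simp add: tensor_matrix_chart[OF that] diag3_def)
    show "((\<lambda>x. (f (x $ 1))\<^sup>2 * (1 - (x $ 2)\<^sup>2)) has_derivative
      (\<lambda>v. 2 * f (u $ 1) * f' (u $ 1) * v $ 1 * (1 - (u $ 2)\<^sup>2)
      - 2 * (u $ 2) * (f (u $ 1))\<^sup>2 * v $ 2)) (at u)"
      by (rule has_derivative_eq_rhs, (rule derivative_intros f_vec_has_derivative[OF u] vec_nth_has_derivative)+)
        (simp add: fun_eq_iff algebra_simps power2_eq_square)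
  qed
  consider "j \<noteq> l \<or> j = 1" | "j = 2" "l = 2" | "j = 3" "l = 3" using exhaust_3[of j] by blast
  then show ?thesis
  proof cases
    case 1
    then show ?thesis using off[of j l] by auto
  next
    case 2
    then show ?thesis using m2 exhaust_3[of i] by (auto simp: axis_def)
  next
    case 3
    then show ?thesis using m3 exhaust_3[of i] by (auto simp: axis_def)
  qed
qed

lemma christoffel_chart:
  assumes u: "u \<in> chart_dom d"
  shows "christoffel (pullback g (chart d R)) k i j u = chart_christoffel (f (u $ 1)) (f' (u $ 1)) (u $ 2) k i j"
proof -
  have nz: "1 - (u $ 2)\<^sup>2 \<noteq> 0" using abs_less_one_sq[of "u $ 2"] u by (simp add: chart_dom_def)
  have nz2: "2 - u $ 2 * u $ 2 * 2 \<noteq> 0" using nz by (simp add: power2_eq_square)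
  have F: "f (u $ 1) \<noteq> 0" using f_pos[of "u $ 1"] u by (simp add: chart_dom_def)
  have inv: "matrix_inv (tensor_matrix (pullback g (chart d R)) u)
    = diag3 ((1 - (u $ 2)\<^sup>2) / (f (u $ 1))\<^sup>2) (1 / ((f (u $ 1))\<^sup>2 * (1 - (u $ 2)\<^sup>2)))"
    unfolding tensor_matrix_chart[OF u] using nz F by (subst matrix_inv_diag3) auto
  have "\<forall>k i j. christoffel (pullback g (chart d R)) k i j u = chart_christoffel (f (u $ 1)) (f' (u $ 1)) (u $ 2) k i j"
    unfolding christoffel_def inv pd_metric[OF u] sum_3 forall_3
    using nz nz2 F by (simp add: diag3_def chart_christoffel_def power2_eq_square) (simp add: frac_eq_eq algebra_simps)
  then show ?thesis by blast
qed

lemma pd_christoffel: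
  assumes u: "u \<in> chart_dom d"
    and "((\<lambda>x. chart_christoffel (f (x $ 1)) (f' (x $ 1)) (x $ 2) k i j) has_derivative D) (at u)"
  shows "pd a (christoffel (pullback g (chart d R)) k i j) u = D (axis a 1)"
  by (rule pd_eqI[OF open_chart_dom u christoffel_chart assms(2)])

text \<open>By rotational symmetry it is enough to evaluate at the point \<open>(s, 0, 0)\<close> on the equator of the
two-sphere, where all terms containing a factor \<open>z\<close> drop out. The inverse metric is diagonal, so
only the diagonal entries of the Ricci tensor enter: \<open>- 2 f''/f\<close> in the radial direction and
\<open>1 - f'\<^sup>2 - f f''\<close> in the two spherical ones.\<close>

lemma scalar_curvature_chart:
  assumes s: "0 < s" "s < d" and f2: "(f' has_real_derivative f2) (at s)"
  shows "scalar_curvature (pullback g (chart d R)) (axis 1 s)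
    = - 4 * f2 / f s + 2 * (1 - (f' s)\<^sup>2) / (f s)\<^sup>2"
proof -
  define u :: "real^3" where "u = axis 1 s"
  let ?m = "pullback g (chart d R)"
  have un: "u $ 1 = s" "u $ 2 = 0" "u $ 3 = 0" by (simp_all add: u_def axis_def)
  have u: "u \<in> chart_dom d" using s by (simp add: chart_dom_def un)
  have F: "f s \<noteq> 0" using f_pos[OF s] by simp
  have Df: "((\<lambda>x. f (x $ 1)) has_derivative (\<lambda>v. f' s * v $ 1)) (at u)"
    using f_vec_has_derivative[OF u] by (simp add: un)
  have "((\<lambda>x. f' (x $ 1)) has_derivative (\<lambda>v. f2 * v $ 1)) (at u)"
    by (rule has_derivative_compose[OF vec_nth_has_derivative]) (use f2 in \<open>simp add: has_field_derivative_def un\<close>)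
  note D = Df this vec_nth_has_derivative
  have z: "pd a (christoffel ?m k i j) u = 0" if "\<And>F G z. chart_christoffel F G z k i j = 0" for a k i j
    by (rule pd_const[OF open_chart_dom u]) (simp add: christoffel_chart that)
  have 1: "pd 1 (christoffel ?m k 1 k) u = (f2 * f s - (f' s)\<^sup>2) / (f s)\<^sup>2" if "k = 2 \<or> k = 3" for k
  proof -
    have "((\<lambda>x. f' (x $ 1) / f (x $ 1)) has_derivative (\<lambda>v. (f2 * f s - (f' s)\<^sup>2) / (f s)\<^sup>2 * v $ 1)) (at u)"
      by (rule has_derivative_eq_rhs, (rule derivative_intros D)+)
        (use F in \<open>simp_all add: un fun_eq_iff field_simps power2_eq_square\<close>)
    moreover have "chart_christoffel F G z k 1 k = G / F" for F G z using that by (auto simp: chart_christoffel_def)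
    ultimately have "((\<lambda>x. chart_christoffel (f (x $ 1)) (f' (x $ 1)) (x $ 2) k 1 k) has_derivative (\<lambda>v. (f2 * f s - (f' s)\<^sup>2) / (f s)\<^sup>2 * v $ 1)) (at u)"
      by simp
    from pd_christoffel[OF u this, of 1] show ?thesis by (simp add: axis_def)
  qed
  have 2: "pd 1 (christoffel ?m 1 i i) u = - (f2 * f s + (f' s)\<^sup>2)" if "i = 2 \<or> i = 3" for i
  proof -
    have "((\<lambda>x. - f (x $ 1) * f' (x $ 1) / (1 - (x $ 2)\<^sup>2)) has_derivative (\<lambda>v. - (f2 * f s + (f' s)\<^sup>2) * v $ 1)) (at u)"
      by (rule has_derivative_eq_rhs, (rule derivative_intros D)+)
        (simp_all add: un fun_eq_iff algebra_simps power2_eq_square)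
    moreover have "((\<lambda>x. - f (x $ 1) * f' (x $ 1) * (1 - (x $ 2)\<^sup>2)) has_derivative (\<lambda>v. - (f2 * f s + (f' s)\<^sup>2) * v $ 1)) (at u)"
      by (rule has_derivative_eq_rhs, (rule derivative_intros D)+)
        (simp_all add: un fun_eq_iff algebra_simps power2_eq_square)
    moreover have "chart_christoffel F G z 1 2 2 = - F * G / (1 - z\<^sup>2)" "chart_christoffel F G z 1 3 3 = - F * G * (1 - z\<^sup>2)" for F G z
      by (simp_all add: chart_christoffel_def)
    ultimately have "((\<lambda>x. chart_christoffel (f (x $ 1)) (f' (x $ 1)) (x $ 2) 1 i i) has_derivative (\<lambda>v. - (f2 * f s + (f' s)\<^sup>2) * v $ 1)) (at u)"
      using that by (elim disjE; simp)
    from pd_christoffel[OF u this, of 1] show ?thesis by (simp add: axis_def)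
  qed
  have 3: "pd 2 (christoffel ?m 2 i i) u = 1" if "i = 2 \<or> i = 3" for i
  proof -
    have "((\<lambda>x. x $ 2 / (1 - (x $ 2)\<^sup>2)) has_derivative (\<lambda>v. v $ 2)) (at u)"
      by (rule has_derivative_eq_rhs, (rule derivative_intros D)+) (simp_all add: un fun_eq_iff)
    moreover have "((\<lambda>x. x $ 2 * (1 - (x $ 2)\<^sup>2)) has_derivative (\<lambda>v. v $ 2)) (at u)"
      by (rule has_derivative_eq_rhs, (rule derivative_intros D)+) (simp_all add: un fun_eq_iff)
    moreover have "chart_christoffel F G z 2 2 2 = z / (1 - z\<^sup>2)" "chart_christoffel F G z 2 3 3 = z * (1 - z\<^sup>2)" for F G z
      by (simp_all add: chart_christoffel_def)
    ultimately have "((\<lambda>x. chart_christoffel (f (x $ 1)) (f' (x $ 1)) (x $ 2) 2 i i) has_derivative (\<lambda>v. v $ 2)) (at u)"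
      using that by (elim disjE; simp)
    from pd_christoffel[OF u this, of 2] show ?thesis by (simp add: axis_def)
  qed
  have 4: "pd 2 (christoffel ?m 3 2 3) u = - 1"
  proof -
    have "((\<lambda>x. - (x $ 2) / (1 - (x $ 2)\<^sup>2)) has_derivative (\<lambda>v. - (v $ 2))) (at u)"
      by (rule has_derivative_eq_rhs, (rule derivative_intros D)+) (simp_all add: un fun_eq_iff)
    moreover have "chart_christoffel F G z 3 2 3 = - z / (1 - z\<^sup>2)" for F G z
      by (simp add: chart_christoffel_def)
    ultimately have "((\<lambda>x. chart_christoffel (f (x $ 1)) (f' (x $ 1)) (x $ 2) 3 2 3) has_derivative (\<lambda>v. - (v $ 2))) (at u)"
      by simp
    from pd_christoffel[OF u this, of 2] show ?thesis by (simp add: axis_def)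
  qed
  have 5: "pd 3 (christoffel ?m k 3 k) u = 0" for k
    using exhaust_3[of k] by (elim disjE; simp only:) (rule z, simp add: chart_christoffel_def)+
  have R1: "ricci ?m 1 1 u = - 2 * f2 / f s"
    unfolding ricci_def sum_3 christoffel_chart[OF u] un
    using F by (simp add: 1 z[of 1 1 1] z[of 2 1 1] z[of 3 1 1] chart_christoffel_def) (simp add: field_simps power2_eq_square)
  have R2: "ricci ?m 2 2 u = 1 - (f' s)\<^sup>2 - f s * f2"
    unfolding ricci_def sum_3 christoffel_chart[OF u] un
    using F by (simp add: 2 3 4 z[of 3 2 2] z[of 1 2 1] chart_christoffel_def field_simps power2_eq_square)
  have R3: "ricci ?m 3 3 u = 1 - (f' s)\<^sup>2 - f s * f2"
    unfolding ricci_def sum_3 christoffel_chart[OF u] un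
    using F by (simp add: 2 3 5 z[of 3 3 3] chart_christoffel_def field_simps power2_eq_square)
  have inv: "matrix_inv (tensor_matrix ?m u) = diag3 (1 / (f s)\<^sup>2) (1 / (f s)\<^sup>2)"
    unfolding tensor_matrix_chart[OF u] un using F by (subst matrix_inv_diag3) auto
  show ?thesis
    unfolding scalar_curvature_def u_def[symmetric] inv sum_3
    using F by (simp add: diag3_def R1 R2 R3 field_simps power2_eq_square)
qed

end

end

section \<open>Latitude spheres at critical radii\<close>

context rot_chart
begin

text \<open>Normal vectors are radial, so only the first component of the trace matters. It consists of the
symbols \<open>\<Gamma>\<^sup>1\<^sub>i\<^sub>j\<close>, which are multiples of \<open>f f'\<close>.\<close>

lemma zero_mean_curvature_slice:
  assumes f': "\<And>s. 0 < s \<Longrightarrow> s < d \<Longrightarrow> (f has_real_derivative f' s) (at s)"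
    and s: "0 < s" "s < d" and crit: "f' s = 0" and u: "u \<in> slice_dom"
  shows "zero_mean_curvature (pullback g (chart d R)) (slice_emb s) u"
  unfolding zero_mean_curvature_def
proof (intro allI impI)
  fix n :: "real^3"
  let ?m = "pullback g (chart d R)" and ?p = "slice_emb s u"
  assume n: "\<forall>a. ?m ?p n (pd a (slice_emb s) u) = 0"
  have p: "?p \<in> chart_dom d" using slice_emb_in[OF s] u by simp
  have Y: "pd a (slice_emb s) x = (axis a 1 $ 1) *\<^sub>R axis 2 1 + (axis a 1 $ 2) *\<^sub>R axis 3 1" for a x
    by (simp add: pd_def slice_emb_frechet)
  have F: "(f s)\<^sup>2 > 0" using f_pos[OF s] by simp
  have z: "1 - (u $ 1)\<^sup>2 > 0" using abs_less_one_sq[of "u $ 1"] u by (simp add: slice_dom_def)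
  have "?m ?p n (axis 2 1) = 0" "?m ?p n (axis 3 1) = 0"
    using n[rule_format, of 1] n[rule_format, of 2] by (simp_all add: Y axis_def)
  then have "n $ 2 = 0" "n $ 3 = 0"
    using F z by (simp_all add: pullback_chart[OF rot R p] axis_def)
  then have "?m ?p n w = n $ 1 * w $ 1" for w
    by (simp add: pullback_chart[OF rot R p])
  moreover have "trace_hessian ?m (slice_emb s) u $ 1 = 0"
  proof -
    have "pd b (slice_emb s) x $ 1 = 0" for b x by (simp add: Y axis_def)
    then have "pd a (\<lambda>x. pd b (slice_emb s) x $ 1) u = 0" for a b
      by (intro pd_const[of UNIV]) auto
    moreover have "christoffel ?m 1 i j ?p = 0" for i j
      by (simp add: christoffel_chart[OF f' p] chart_christoffel_def crit)
    ultimately show ?thesis by (simp add: trace_hessian_def)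
  qed
  ultimately show "?m ?p n (trace_hessian ?m (slice_emb s) u) = 0" by simp
qed

text \<open>The two diagonal entries of the induced metric multiply to \<open>f(s)\<^sup>4\<close>, independently of \<open>u\<close>.\<close>

lemma area_element_slice:
  assumes s: "0 < s" "s < d" and u: "u \<in> slice_dom"
  shows "sqrt (det (tensor_matrix (pullback g (slice_param s)) u)) = (f s)\<^sup>2"
proof -
  have p: "slice_emb s u \<in> chart_dom d" using slice_emb_in[OF s] u by simp
  have z: "1 - (u $ 1)\<^sup>2 \<noteq> 0" using abs_less_one_sq[of "u $ 1"] u by (simp add: slice_dom_def)
  have pb: "pullback g (slice_param s) u v w = (f s)\<^sup>2 * (v $ 1 * w $ 1 / (1 - (u $ 1)\<^sup>2) + v $ 2 * w $ 2 * (1 - (u $ 1)\<^sup>2))" for v w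
  proof -
    have "pullback g (slice_param s) u v w = pullback (pullback g (chart d R)) (slice_emb s) u v w"
      unfolding slice_param_def
      by (rule pullback_comp[OF differentiableI[OF slice_emb_has_derivative] chart_differentiable[OF p]])
    also have "\<dots> = pullback g (chart d R) (slice_emb s u)
        (v $ 1 *\<^sub>R axis 2 1 + v $ 2 *\<^sub>R axis 3 1) (w $ 1 *\<^sub>R axis 2 1 + w $ 2 *\<^sub>R axis 3 1)"
      by (simp add: pullback_def[of _ "slice_emb s"] slice_emb_frechet)
    also have "\<dots> = (f s)\<^sup>2 * (v $ 1 * w $ 1 / (1 - (u $ 1)\<^sup>2) + v $ 2 * w $ 2 * (1 - (u $ 1)\<^sup>2))"
      unfolding pullback_chart[OF rot R p] by (simp add: axis_def)
    finally show ?thesis .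
  qed
  have "det (tensor_matrix (pullback g (slice_param s)) u) = ((f s)\<^sup>2)\<^sup>2"
    unfolding tensor_matrix_def pb det_2 using z by (simp add: axis_def power2_eq_square)
  then show ?thesis by (simp only: real_sqrt_abs abs_power2)
qed

end

text \<open>The chart turned by this involution omits a half great circle that is disjoint from the one
omitted by the unturned chart.\<close>

definition axis_swap :: "real^3 \<Rightarrow> real^3" where
  "axis_swap w = (- (w $ 1)) *\<^sub>R axis 1 1 + (w $ 3) *\<^sub>R axis 2 1 + (w $ 2) *\<^sub>R axis 3 1"

lemma axis_swap_nth [simp]: "axis_swap w $ 1 = - (w $ 1)" "axis_swap w $ 2 = w $ 3" "axis_swap w $ 3 = w $ 2"
  by (simp_all add: axis_swap_def axis_def)

lemma chart_frame_id: "0 < d \<Longrightarrow> chart_frame d (\<lambda>x. x)"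
  by unfold_locales (simp_all add: orthogonal_transformation_def linear_iff)

lemma chart_frame_axis_swap: "0 < d \<Longrightarrow> chart_frame d axis_swap"
proof unfold_locales
  show "orthogonal_transformation axis_swap"
    unfolding orthogonal_transformation_def linear_iff
    by (simp add: vec_eq_iff forall_3 inner_real3)
qed (simp_all add: vec_eq_iff forall_3)

lemma rot_symmetric_pos: "rot_symmetric g d f \<Longrightarrow> 0 < d"
  by (simp add: rot_symmetric_def)

lemma rot_chart_id: "rot_symmetric g d f \<Longrightarrow> rot_chart d (\<lambda>x. x) g f"
  by (simp add: rot_chart_def rot_chart_axioms_def chart_frame_id rot_symmetric_pos)

lemma rot_chart_axis_swap: "rot_symmetric g d f \<Longrightarrow> rot_chart d axis_swap g f"
  by (simp add: rot_chart_def rot_chart_axioms_def chart_frame_axis_swap rot_symmetric_pos)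

text \<open>A point outside both charts would lie on both half planes, hence on the axis through the poles of
the three-sphere, and no pole has a radius strictly between \<open>0\<close> and \<open>d\<close>.\<close>

lemma slice_covered:
  assumes "0 < s" "s < d" "q \<in> slice d s"
  shows "q \<in> chart_image (\<lambda>x. x) \<or> q \<in> chart_image axis_swap"
proof (rule ccontr)
  assume "\<not> ?thesis"
  then have "snd q = 0" using assms(3)
    by (auto simp: chart_image_def slice_def slit_def vec_eq_iff forall_3)
  then have "(cos (pi * s / d))\<^sup>2 = 1" using assms(3) by (auto simp: slice_def S3_iff)
  then have "sin (pi * s / d) = 0" using sin_squared_eq[of "pi * s / d"] by simp
  moreover have "0 < sin (pi * s / d)"
    using assms by (intro sin_gt_zero) (auto simp: field_simps)
  ultimately show False by simp
qed

lemma slice_eq_image: "0 < s \<Longrightarrow> s < d \<Longrightarrow> slice d s = (\<lambda>w. polar d (s, w)) ` sphere 0 1"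
proof
  assume s: "0 < s" "s < d"
  then have S: "0 < sin (pi * s / d)" by (intro sin_gt_zero) (auto simp: field_simps)
  show "(\<lambda>w. polar d (s, w)) ` sphere 0 1 \<subseteq> slice d s"
    by (auto simp: slice_def S3_iff polar_def)
  show "slice d s \<subseteq> (\<lambda>w. polar d (s, w)) ` sphere 0 1"
  proof
    fix q assume q: "q \<in> slice d s"
    then have "(norm (snd q))\<^sup>2 = (sin (pi * s / d))\<^sup>2"
      by (auto simp: slice_def S3_iff sin_squared_eq)
    then have n: "norm (snd q) = sin (pi * s / d)" using S by (simp add: power2_eq_iff_nonneg)
    have "q = polar d (s, snd q /\<^sub>R norm (snd q))"
      using q S by (simp add: polar_def n prod_eq_iff slice_def)
    moreover have "snd q /\<^sub>R norm (snd q) \<in> sphere 0 1" using S by (simp add: n[symmetric])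
    ultimately show "q \<in> (\<lambda>w. polar d (s, w)) ` sphere 0 1" by blast
  qed
qed

lemma slice_topology:
  assumes "0 < s" "s < d"
  shows "slice d s \<noteq> {}" "compact (slice d s)" "connected (slice d s)"
proof -
  have c: "continuous_on (sphere 0 1) (\<lambda>w::real^3. polar d (s, w))"
    unfolding polar_def case_prod_conv by (intro continuous_intros)
  show "slice d s \<noteq> {}" "compact (slice d s)" "connected (slice d s)"
    unfolding slice_eq_image[OF assms]
    using compact_continuous_image[OF c] connected_continuous_image[OF c] connected_sphere[of "0::real^3" 1]
    by simp_all
qed

lemma slice_minimal:
  assumes g: "rot_symmetric g d f" and f': "\<And>s. 0 < s \<Longrightarrow> s < d \<Longrightarrow> (f has_real_derivative f' s) (at s)"
    and s: "0 < s" "s < d" and crit: "f' s = 0"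
  shows "closed_embedded_minimal_surface g (slice d s)"
proof -
  have one: "\<exists>U (\<phi> :: real^3 \<Rightarrow> pt) V Y. local_param S3 U \<phi> \<and> smooth_on V Y \<and> Y ` V \<subseteq> U \<and>
      local_param (slice d s) V (\<phi> \<circ> Y) \<and> q \<in> \<phi> ` Y ` V \<and> (\<forall>u\<in>V. zero_mean_curvature (pullback g \<phi>) Y u)"
    if R: "rot_chart d R g f" and q: "q \<in> slice d s" "q \<in> chart_image R" for R q
  proof (intro exI conjI ballI)
    interpret rot_chart d R g f by (rule R)
    show "local_param S3 (chart_dom d) (chart d R)" by (rule local_param_chart)
    show "smooth_on slice_dom (slice_emb s)" by (rule smooth_slice_emb[OF open_slice_dom])
    show "slice_emb s ` slice_dom \<subseteq> chart_dom d" using slice_emb_in[OF s] by blast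
    show "local_param (slice d s) slice_dom (chart d R \<circ> slice_emb s)"
      using local_param_slice[OF s] by (simp add: slice_param_def)
    show "q \<in> chart d R ` slice_emb s ` slice_dom"
      using slice_param_image[OF s] q by (simp add: slice_param_def image_comp)
    show "zero_mean_curvature (pullback g (chart d R)) (slice_emb s) u" if "u \<in> slice_dom" for u
      by (rule zero_mean_curvature_slice[OF f' s crit that])
  qed
  have two: "\<exists>R. rot_chart d R g f \<and> q \<in> chart_image R" if "q \<in> slice d s" for q
    using slice_covered[OF s that] rot_chart_id[OF g] rot_chart_axis_swap[OF g] by blast
  have "\<exists>V (X :: real^2 \<Rightarrow> pt). local_param (slice d s) V X \<and> q \<in> X ` V" if q: "q \<in> slice d s" for q
  proof -
    obtain R where R: "rot_chart d R g f" "q \<in> chart_image R" using two[OF q] by blast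
    show ?thesis
      using rot_chart.local_param_slice[OF R(1) s] rot_chart.slice_param_image[OF R(1) s] R(2) q by blast
  qed
  then have "closed_embedded_surface (slice d s)"
    unfolding closed_embedded_surface_def using slice_topology[OF s] by (auto simp: slice_def)
  moreover have "\<exists>U (\<phi> :: real^3 \<Rightarrow> pt) V Y. local_param S3 U \<phi> \<and> smooth_on V Y \<and> Y ` V \<subseteq> U \<and>
      local_param (slice d s) V (\<phi> \<circ> Y) \<and> q \<in> \<phi> ` Y ` V \<and> (\<forall>u\<in>V. zero_mean_curvature (pullback g \<phi>) Y u)"
    if q: "q \<in> slice d s" for q
  proof -
    obtain R where R: "rot_chart d R g f" "q \<in> chart_image R" using two[OF q] by blast
    show ?thesis by (rule one[OF R(1) q R(2)])
  qed
  ultimately show ?thesis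
    unfolding closed_embedded_minimal_surface_def by blast
qed

lemma emeasure_slice_dom: "emeasure lborel slice_dom = ennreal (4 * pi)"
proof -
  define a :: "real^2" where "a = axis 1 1 + pi *\<^sub>R axis 2 1"
  have a: "a $ 1 = 1" "a $ 2 = pi" by (simp_all add: a_def axis_def)
  have B: "Basis = {axis 1 1, axis 2 1 :: real^2}" by (auto simp: Basis_vec_def UNIV_2)
  have "axis 1 1 \<noteq> (axis 2 1 :: real^2)" by (simp add: axis_eq_axis)
  then have "emeasure lborel (box (- a) a) = ennreal (4 * pi)"
    by (subst emeasure_lborel_box) (auto simp: B inner_axis a)
  moreover have "slice_dom = box (- a) a"
    by (auto simp: slice_dom_def mem_box_cart forall_2 a abs_less_iff)
  ultimately show ?thesis by simp
qed

text \<open>The unturned chart covers the latitude sphere up to a half great circle and accounts for the whole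
area. The rest lies in the turned chart, over a segment of the line \<open>z = 0\<close>, and has area zero.\<close>

lemma slice_area:
  assumes g: "rot_symmetric g d f" and s: "0 < s" "s < d"
  shows "has_area g (slice d s) (ennreal (4 * pi * (f s)\<^sup>2))"
proof -
  interpret I: rot_chart d "\<lambda>x. x" g f by (rule rot_chart_id[OF g])
  interpret J: rot_chart d axis_swap g f by (rule rot_chart_axis_swap[OF g])
  let ?C = "chart_image (\<lambda>x. x)"
  define X where "X i = (if i = (0::nat) then I.slice_param s else J.slice_param s)" for i
  define E where "E i = (if i = (0::nat) then slice d s \<inter> ?C else slice d s - ?C)" for i
  have bor: "slice d s \<in> sets borel" using slice_topology[OF s] by (simp add: compact_imp_closed)
  obtain T where "open T" "?C = S3 \<inter> T" using I.openin_chart_image by (auto simp: openin_open)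
  moreover have "closed S3" by (simp add: S3_def)
  ultimately have borC: "?C \<in> sets borel" by auto
  have cov: "slice d s - ?C \<subseteq> chart_image axis_swap" using slice_covered[OF s] by blast
  have E: "local_param (slice d s) slice_dom (X i) \<and> E i \<in> sets borel \<and> E i \<subseteq> X i ` slice_dom" if "i < 2" for i
    using I.local_param_slice[OF s] J.local_param_slice[OF s] I.slice_param_image[OF s] J.slice_param_image[OF s]
      cov bor borC
    by (auto simp: X_def E_def)
  have dis: "disjoint_family_on E {..<2}" by (auto simp: disjoint_family_on_def E_def)
  have un: "(\<Union>i<2. E i) = slice d s" by (auto simp: E_def lessThan_Suc numeral_2_eq_2)
  let ?a = "\<lambda>i. \<integral>\<^sup>+u\<in>{u \<in> slice_dom. X i u \<in> E i}. ennreal (sqrt (det (tensor_matrix (pullback g (X i)) u))) \<partial>lborel"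
  have "{u \<in> slice_dom. X 0 u \<in> E 0} = slice_dom"
    using I.slice_param_in[OF s] by (auto simp: X_def E_def)
  then have "?a 0 = (\<integral>\<^sup>+u. ennreal ((f s)\<^sup>2) * indicator slice_dom u \<partial>lborel)"
    by (intro nn_integral_cong) (auto simp: X_def I.area_element_slice[OF s] split: split_indicator)
  also have "\<dots> = ennreal ((f s)\<^sup>2) * emeasure lborel slice_dom"
    using open_slice_dom by (intro nn_integral_cmult_indicator) auto
  also have "\<dots> = ennreal (4 * pi * (f s)\<^sup>2)"
    by (simp add: emeasure_slice_dom mult.commute flip: ennreal_mult)
  finally have a0: "?a 0 = ennreal (4 * pi * (f s)\<^sup>2)" .
  define N where "N = {u::real^2. u $ 1 = 0}"
  have "N \<in> null_sets lebesgue"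
    using negligible_standard_hyperplane_cart[of 1] by (simp add: N_def negligible_iff_null_sets)
  moreover have "closed N" unfolding N_def by (intro closed_Collect_eq continuous_intros)
  ultimately have N: "N \<in> null_sets lborel"
    by (auto simp: null_sets_def)
  have sub: "{u \<in> slice_dom. X 1 u \<in> E 1} \<subseteq> N"
  proof
    fix u assume u: "u \<in> {u \<in> slice_dom. X 1 u \<in> E 1}"
    have "0 < sin (pi * s / d)" by (rule I.sin_pos[OF s])
    moreover have "snd (J.slice_param s u) \<in> slit"
      using u J.slice_param_in[OF s, of u] by (auto simp: X_def E_def chart_image_def)
    then have "sin (pi * s / d) * u $ 1 = 0"
      by (simp add: J.slice_param_def chart_def polar_def slit_def)
    ultimately show "u \<in> N" by (simp add: N_def)
  qed
  have "?a 1 \<le> (\<integral>\<^sup>+u\<in>N. ennreal (sqrt (det (tensor_matrix (pullback g (X 1)) u))) \<partial>lborel)"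
    using sub by (intro nn_integral_mono) (auto split: split_indicator)
  also have "\<dots> = 0" by (rule nn_integral_null_set[OF N])
  finally have a1: "?a 1 = 0" by simp
  have "ennreal (4 * pi * (f s)\<^sup>2) = (\<Sum>i<2. ?a i)"
    using a0 a1 by (simp add: numeral_2_eq_2)
  then show ?thesis
    unfolding has_area_def using E dis un
    by (intro exI[of _ 2] exI[of _ "\<lambda>_. slice_dom"] exI[of _ X] exI[of _ E]) simp
qed

text \<open>The latitude sphere is one of the surfaces over which \<open>MinA\<close> takes the infimum of the areas.\<close>

lemma critical_radius_bound:
  assumes g: "rot_symmetric g d f" and f': "\<And>s. 0 < s \<Longrightarrow> s < d \<Longrightarrow> (f has_real_derivative f' s) (at s)"
    and A: "ennreal A \<le> MinA g" and s: "0 < s" "s < d" and crit: "f' s = 0"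
  shows "sqrt (A / (4 * pi)) \<le> f s"
proof -
  have "MinA g \<le> ennreal (4 * pi * (f s)\<^sup>2)"
    unfolding MinA_def using slice_minimal[OF g f' s crit] slice_area[OF g s] by (intro Inf_lower) blast
  from order_trans[OF A this] have "A \<le> 4 * pi * (f s)\<^sup>2" by (simp add: ennreal_le_iff)
  then have "A / (4 * pi) \<le> (f s)\<^sup>2" by (simp add: field_simps)
  then show ?thesis
    using rot_chart.f_pos[OF rot_chart_id[OF g] s] by (intro real_le_lsqrt) auto
qed

section \<open>The slope of the warping function\<close>

text \<open>One-sided at the ends, so that the slope is continuous up to the poles.\<close>

lemma smooth_on_interval_derivative:
  fixes f :: "real \<Rightarrow> real"
  assumes "smooth_on {a..b} f"
  obtains f' where "\<And>s. s \<in> {a..b} \<Longrightarrow> (f has_real_derivative f' s) (at s within {a..b})"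
    and "smooth_on {a..b} f'"
proof
  let ?f' = "\<lambda>s. frechet_derivative f (at s within {a..b}) 1"
  have C: "Ck_on (Suc k) {a..b} f" for k using assms unfolding smooth_on_def by (rule spec)
  show "smooth_on {a..b} ?f'"
    unfolding smooth_on_def using C unfolding Ck_on.simps by blast
  fix s assume s: "s \<in> {a..b}"
  have "f differentiable_on {a..b}" using C[of 0] unfolding Ck_on.simps by (rule conjunct1)
  then have df: "f differentiable (at s within {a..b})" using s unfolding differentiable_on_def by (rule bspec)
  then have "(f has_derivative frechet_derivative f (at s within {a..b})) (at s within {a..b})"
    by (rule frechet_derivative_works[THEN iffD1])
  moreover have "frechet_derivative f (at s within {a..b}) = (*) (?f' s)"
  proof
    fix v :: real
    show "frechet_derivative f (at s within {a..b}) v = ?f' s * v"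
      using linear_scale[OF linear_frechet_derivative[OF df], of v 1]
      unfolding real_scaleR_def mult_1_right by (metis mult.commute)
  qed
  ultimately show "(f has_real_derivative ?f' s) (at s within {a..b})"
    unfolding has_field_derivative_def by metis
qed

lemma has_real_derivative_unique_within_Icc:
  fixes f :: "real \<Rightarrow> real"
  assumes "(f has_real_derivative x) (at s within {a..b})" "(f has_real_derivative y) (at s within {a..b})"
    and "a < b" "s \<in> {a..b}"
  shows "x = y"
  using vector_derivative_unique_within_closed_interval[of a b s f x y] assms
  by (simp add: has_real_derivative_iff_has_vector_derivative)

lemma rot_symmetric_derivative:
  assumes "rot_symmetric g d f"
  obtains f' where "\<And>s. s \<in> {0..d} \<Longrightarrow> (f has_real_derivative f' s) (at s within {0..d})"
    "continuous_on {0..d} f'" "f' 0 = 1" "f' d = - 1"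
    "\<And>s. 0 < s \<Longrightarrow> s < d \<Longrightarrow> \<exists>f2. (f' has_real_derivative f2) (at s)"
proof -
  have d: "0 < d" and sm: "smooth_on {0..d} f" and "(f has_real_derivative 1) (at 0 within {0..d})"
    and "(f has_real_derivative -1) (at d within {0..d})"
    using assms unfolding rot_symmetric_def by simp_all
  note f01 = this(3,4)
  obtain f' where f': "\<And>s. s \<in> {0..d} \<Longrightarrow> (f has_real_derivative f' s) (at s within {0..d})"
    and s1: "smooth_on {0..d} f'" using smooth_on_interval_derivative[OF sm] by blast
  obtain f'' where f'': "\<And>s. s \<in> {0..d} \<Longrightarrow> (f' has_real_derivative f'' s) (at s within {0..d})"
    using smooth_on_interval_derivative[OF s1] by blast
  show ?thesis
  proof (rule that[OF f'])
    show "continuous_on {0..d} f'" using f'' by (rule DERIV_continuous_on)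
    show "f' 0 = 1" using has_real_derivative_unique_within_Icc[OF f' f01(1)] d by simp
    show "f' d = - 1" using has_real_derivative_unique_within_Icc[OF f' f01(2)] d by simp
    show "\<exists>f2. (f' has_real_derivative f2) (at s)" if "0 < s" "s < d" for s
      using f''[of s] that at_within_Icc_at[of 0 s d] by auto
  qed
qed

text \<open>With \<open>f''(s) = 0\<close> the scalar curvature reduces to \<open>2 (1 - f'(s)\<^sup>2)/f(s)\<^sup>2\<close>.\<close>

lemma slope_bound_at_critical_slope:
  assumes R: "rot_chart d R g f" and K: "nonneg_scalar_curvature g"
    and f': "\<And>s. 0 < s \<Longrightarrow> s < d \<Longrightarrow> (f has_real_derivative f' s) (at s)"
    and s: "0 < s" "s < d" and f2: "(f' has_real_derivative 0) (at s)"
  shows "\<bar>f' s\<bar> \<le> 1"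
proof -
  interpret rot_chart d R g f by (rule R)
  have "axis 1 s \<in> chart_dom d" using s by (simp add: chart_dom_def axis_def)
  then have "0 \<le> scalar_curvature (pullback g (chart d R)) (axis 1 s)"
    using K local_param_chart unfolding nonneg_scalar_curvature_def by blast
  then have "0 \<le> 2 * (1 - (f' s)\<^sup>2) / (f s)\<^sup>2"
    using scalar_curvature_chart[OF f' s f2] by simp
  then have "(f' s)\<^sup>2 \<le> 1" using f_pos[OF s] by (simp add: zero_le_divide_iff)
  then show ?thesis by (simp add: abs_square_le_1)
qed

text \<open>An interior extremum of the slope is a zero of \<open>f''\<close>, where the scalar curvature bounds the slope by
\<open>1\<close>. At both ends its absolute value is \<open>1\<close>.\<close>

lemma slope_bound:
  assumes g: "rot_symmetric g d f" and K: "nonneg_scalar_curvature g"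
    and f': "\<And>s. s \<in> {0..d} \<Longrightarrow> (f has_real_derivative f' s) (at s within {0..d})"
    and c: "continuous_on {0..d} f'" and ends: "f' 0 = 1" "f' d = - 1"
    and f2: "\<And>s. 0 < s \<Longrightarrow> s < d \<Longrightarrow> \<exists>f2. (f' has_real_derivative f2) (at s)"
    and s: "s \<in> {0..d}"
  shows "\<bar>f' s\<bar> \<le> 1"
proof -
  have d: "0 < d" by (rule rot_symmetric_pos[OF g])
  have f'i: "(f has_real_derivative f' s) (at s)" if "0 < s" "s < d" for s
    using f'[of s] that at_within_Icc_at[of 0 s d] by simp
  note crit = slope_bound_at_critical_slope[OF rot_chart_id[OF g] K f'i]
  have ne: "{0..d} \<noteq> {}" using d by simp
  obtain x where x: "x \<in> {0..d}" "\<And>y. y \<in> {0..d} \<Longrightarrow> f' y \<le> f' x"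
    using continuous_attains_sup[OF compact_Icc ne c] by blast
  have "f' x \<le> 1"
  proof (cases "0 < x \<and> x < d")
    case True
    then obtain e where e: "(f' has_real_derivative e) (at x)" using f2 by blast
    have "e = 0"
      by (rule DERIV_local_max[OF e, of "min x (d - x)"]) (use True in \<open>auto intro!: x(2)\<close>)
    then show ?thesis using crit[of x] True e by simp
  next
    case False
    then have "x = 0 \<or> x = d" using x(1) by auto
    then show ?thesis using ends by auto
  qed
  moreover obtain y where y: "y \<in> {0..d}" "\<And>z. z \<in> {0..d} \<Longrightarrow> f' y \<le> f' z"
    using continuous_attains_inf[OF compact_Icc ne c] by blast
  have "- 1 \<le> f' y"
  proof (cases "0 < y \<and> y < d")
    case True
    then obtain e where e: "(f' has_real_derivative e) (at y)" using f2 by blast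
    have "e = 0"
      by (rule DERIV_local_min[OF e, of "min y (d - y)"]) (use True in \<open>auto intro!: y(2)\<close>)
    then show ?thesis using crit[of y] True e by simp
  next
    case False
    then have "y = 0 \<or> y = d" using y(1) by auto
    then show ?thesis using ends by auto
  qed
  ultimately show ?thesis using x(2)[OF s] y(2)[OF s] by linarith
qed

section \<open>The ends of the monotone stretches\<close>

lemma increasing_end_sup:
  assumes d: "0 < d"
  shows "0 \<le> increasing_end d f" "increasing_end d f \<le> d"
    and "s \<in> {0..d} \<Longrightarrow> strict_mono_on {0..s} f \<Longrightarrow> s \<le> increasing_end d f"
    and "y < increasing_end d f \<Longrightarrow> \<exists>s. y < s \<and> s \<le> increasing_end d f \<and> 0 \<le> s \<and> strict_mono_on {0..s} f"
proof -
  let ?S = "{s \<in> {0..d}. strict_mono_on {0..s} f}"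
  have bdd: "bdd_above ?S" by (auto intro!: bdd_aboveI[of _ d])
  have 0: "0 \<in> ?S" using d by (auto simp: monotone_on_def)
  show up: "s \<in> {0..d} \<Longrightarrow> strict_mono_on {0..s} f \<Longrightarrow> s \<le> increasing_end d f" for s
    unfolding increasing_end_def by (rule cSup_upper[OF _ bdd]) simp
  show "0 \<le> increasing_end d f" using 0 up by blast
  show "increasing_end d f \<le> d"
    unfolding increasing_end_def using 0 by (intro cSup_least) auto
  show "\<exists>s. y < s \<and> s \<le> increasing_end d f \<and> 0 \<le> s \<and> strict_mono_on {0..s} f" if y: "y < increasing_end d f"
  proof -
    have "?S \<noteq> {}" using 0 by blast
    then obtain s where "s \<in> ?S" "y < s"
      using y less_cSup_iff[OF _ bdd] unfolding increasing_end_def by blast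
    then show ?thesis using up by auto
  qed
qed

text \<open>If the slope at this point were positive, \<open>f\<close> would keep increasing a little beyond it; if it were
negative, \<open>f\<close> would decrease already before it. The signs of the slope at \<open>0\<close> and \<open>d\<close> then rule
out both ends.\<close>

lemma increasing_end_critical:
  fixes f f' :: "real \<Rightarrow> real"
  assumes d: "0 < d" and f': "\<And>s. s \<in> {0..d} \<Longrightarrow> (f has_real_derivative f' s) (at s within {0..d})"
    and c: "continuous_on {0..d} f'" and ends: "0 < f' 0" "f' d < 0"
  shows "f' (increasing_end d f) = 0" "0 < increasing_end d f" "increasing_end d f < d"
proof -
  define a where "a = increasing_end d f"
  note props = increasing_end_sup[OF d, where f = f, folded a_def]
  have a: "a \<in> {0..d}" using props(1,2) by simp
  have f'i: "(f has_real_derivative f' s) (at s)" if "0 < s" "s < d" for s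
    using f'[of s] that at_within_Icc_at[of 0 s d] by simp
  have cf: "continuous_on {0..d} f" using f' by (rule DERIV_continuous_on)
  have inc: "f x < f y" if xy: "0 \<le> x" "x < y" "y \<le> d" and pos: "\<And>z. x < z \<Longrightarrow> z < y \<Longrightarrow> 0 < f' z" for x y
  proof (rule DERIV_pos_imp_increasing_open[OF xy(2)])
    show "continuous_on {x..y} f" using cf by (rule continuous_on_subset) (use xy in auto)
    show "\<exists>l. (f has_real_derivative l) (at z) \<and> 0 < l" if "x < z" "z < y" for z
      using f'i[of z] pos[OF that] that xy by auto
  qed
  have dec: "f y < f x" if xy: "0 \<le> x" "x < y" "y \<le> d" and pos: "\<And>z. x < z \<Longrightarrow> z < y \<Longrightarrow> f' z < 0" for x y
  proof (rule DERIV_neg_imp_decreasing_open[OF xy(2)])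
    show "continuous_on {x..y} f" using cf by (rule continuous_on_subset) (use xy in auto)
    show "\<exists>l. (f has_real_derivative l) (at z) \<and> l < 0" if "x < z" "z < y" for z
      using f'i[of z] pos[OF that] that xy by auto
  qed
  have near: "\<exists>e>0. \<forall>z\<in>{0..d}. \<bar>z - a\<bar> < e \<longrightarrow> \<bar>f' z - f' a\<bar> < \<bar>f' a\<bar>" if "f' a \<noteq> 0"
    using c[unfolded continuous_on_iff, rule_format, OF a, of "\<bar>f' a\<bar>"] that by (simp add: dist_real_def)
  have "\<not> 0 < f' a"
  proof
    assume pos: "0 < f' a"
    then have "a \<noteq> d" using ends by auto
    then have ad: "a < d" using a by auto
    obtain e where e: "0 < e" "\<And>z. z \<in> {0..d} \<Longrightarrow> \<bar>z - a\<bar> < e \<Longrightarrow> 0 < f' z"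
      using near pos by force
    have "\<exists>t. a - e < t \<and> t \<le> a \<and> 0 \<le> t \<and> strict_mono_on {0..t} f"
      using props(4)[of "a - e"] e(1) by auto
    then obtain t where t: "a - e < t" "t \<le> a" "0 \<le> t" "strict_mono_on {0..t} f" by blast
    define b where "b = min d (a + e / 2)"
    have b: "a < b" "b \<le> d" "b < a + e" using ad e(1) by (auto simp: b_def)
    have tb: "f x < f y" if "t \<le> x" "x < y" "y \<le> b" for x y
      by (rule inc) (use that t b in \<open>auto intro!: e(2)\<close>)
    have "strict_mono_on {0..b} f"
    proof (rule strict_mono_onI)
      fix x y assume xy: "x \<in> {0..b}" "y \<in> {0..b}" "x < y"
      have st: "f x < f y" if "x \<in> {0..t}" "y \<in> {0..t}" "x < y" for x y
        using t(4) that by (rule strict_mono_onD)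
      consider "y \<le> t" | "t \<le> x" | "x < t" "t < y" by linarith
      then show "f x < f y"
      proof cases
        case 3
        have "f x < f t" using st[of x t] 3 xy t by simp
        also have "f t < f y" using tb[of t y] 3 xy by simp
        finally show ?thesis .
      qed (use st[of x y] tb[of x y] xy in auto)
    qed
    then have "b \<le> a" using props(3)[of b] a b by simp
    then show False using b by simp
  qed
  moreover have "\<not> f' a < 0"
  proof
    assume neg: "f' a < 0"
    then have "a \<noteq> 0" using ends by auto
    then have a0: "0 < a" using a by auto
    obtain e where e: "0 < e" "\<And>z. z \<in> {0..d} \<Longrightarrow> \<bar>z - a\<bar> < e \<Longrightarrow> f' z < 0"
      using near neg by force
    define x where "x = max 0 (a - e / 2)"
    have x: "0 \<le> x" "x < a" "a - e < x" using a0 e(1) by (auto simp: x_def)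
    obtain t where t: "x < t" "t \<le> a" "strict_mono_on {0..t} f" using props(4)[OF x(2)] by blast
    have "f x < f t" using t(3) by (rule strict_mono_onD) (use x t in auto)
    moreover have "f t < f x"
      by (rule dec) (use x t a in \<open>auto intro!: e(2)\<close>)
    ultimately show False by simp
  qed
  ultimately show z: "f' (increasing_end d f) = 0" by (simp add: a_def)
  show "0 < increasing_end d f" "increasing_end d f < d"
    using z a ends by (auto simp: a_def[symmetric] less_le)
qed

text \<open>The reflection \<open>s \<mapsto> d - s\<close> reduces statements about the decreasing stretch to the increasing one.\<close>

lemma decreasing_start_reflect:
  assumes d: "0 < d"
  shows "decreasing_start d f = d - increasing_end d (\<lambda>s. f (d - s))"
proof -
  let ?h = "\<lambda>s. f (d - s)"
  have iff: "strict_antimono_on {s..d} f \<longleftrightarrow> strict_mono_on {0..d - s} ?h" for s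
  proof
    assume a: "strict_antimono_on {s..d} f"
    show "strict_mono_on {0..d - s} ?h"
    proof (rule strict_mono_onI)
      fix x y assume "x \<in> {0..d - s}" "y \<in> {0..d - s}" "x < y"
      then show "f (d - x) < f (d - y)"
        using monotone_onD[OF a, of "d - y" "d - x"] by auto
    qed
  next
    assume a: "strict_mono_on {0..d - s} ?h"
    show "strict_antimono_on {s..d} f"
    proof (rule monotone_onI)
      fix x y assume "x \<in> {s..d}" "y \<in> {s..d}" "x < y"
      then show "f x > f y"
        using strict_mono_onD[OF a, of "d - y" "d - x"] by auto
    qed
  qed
  note props = increasing_end_sup[OF d, where f = ?h]
  let ?T = "{s \<in> {0..d}. strict_antimono_on {s..d} f}"
  have "d - increasing_end d ?h \<le> t" if "t \<in> ?T" for t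
    using props(3)[of "d - t"] that iff[of t] by auto
  moreover have "d \<in> ?T" using d by (auto simp: monotone_on_def)
  ultimately have 1: "d - increasing_end d ?h \<le> Inf ?T" by (intro cInf_greatest) auto
  have "Inf ?T \<le> y" if y: "d - increasing_end d ?h < y" for y
  proof -
    have "d - y < increasing_end d ?h" using y by simp
    then obtain s where s: "d - y < s" "s \<le> increasing_end d ?h" "0 \<le> s" "strict_mono_on {0..s} ?h"
      using props(4) by blast
    then have "d - s \<in> ?T" using iff[of "d - s"] props(2) by auto
    then have "Inf ?T \<le> d - s" by (intro cInf_lower) (auto intro!: bdd_belowI[of _ 0])
    then show ?thesis using s by simp
  qed
  then have "Inf ?T \<le> d - increasing_end d ?h" by (rule dense_ge)
  with 1 show ?thesis by (simp add: decreasing_start_def)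
qed

lemma decreasing_start_approach:
  assumes d: "0 < d"
  shows "y > decreasing_start d f \<Longrightarrow> \<exists>s. s < y \<and> s \<in> {0..d} \<and> strict_antimono_on {s..d} f"
proof -
  let ?T = "{s \<in> {0..d}. strict_antimono_on {s..d} f}"
  assume y: "y > decreasing_start d f"
  have "d \<in> ?T" using d by (auto simp: monotone_on_def)
  then have "?T \<noteq> {}" by blast
  moreover have "bdd_below ?T" by (auto intro!: bdd_belowI[of _ 0])
  ultimately show ?thesis using y cInf_less_iff[of ?T y] unfolding decreasing_start_def by blast
qed

lemma decreasing_start_critical:
  fixes f f' :: "real \<Rightarrow> real"
  assumes d: "0 < d" and f': "\<And>s. s \<in> {0..d} \<Longrightarrow> (f has_real_derivative f' s) (at s within {0..d})"
    and c: "continuous_on {0..d} f'" and ends: "0 < f' 0" "f' d < 0"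
  shows "f' (decreasing_start d f) = 0" "0 < decreasing_start d f" "decreasing_start d f < d"
proof -
  let ?h = "\<lambda>s. f (d - s)" and ?h' = "\<lambda>s. - f' (d - s)"
  have img: "(\<lambda>s. d - s) ` {0..d} = {0..d}" by simp
  have "(?h has_real_derivative ?h' s) (at s within {0..d})" if s: "s \<in> {0..d}" for s
  proof -
    have 1: "(f has_real_derivative f' (d - s)) (at (d - s) within (\<lambda>s. d - s) ` {0..d})"
      unfolding img by (rule f') (use s in auto)
    have 2: "((\<lambda>s. d - s) has_real_derivative - 1) (at s within {0..d})"
      by (auto intro!: derivative_eq_intros)
    show ?thesis using DERIV_image_chain[OF 1 2] by (simp add: o_def)
  qed
  moreover have "continuous_on {0..d} ?h'"
    by (intro continuous_on_minus continuous_on_compose2[OF c] continuous_intros) auto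
  ultimately have "?h' (increasing_end d ?h) = 0 \<and> 0 < increasing_end d ?h \<and> increasing_end d ?h < d"
    using increasing_end_critical[OF d, of ?h ?h'] ends by auto
  then show "f' (decreasing_start d f) = 0" "0 < decreasing_start d f" "decreasing_start d f < d"
    by (simp_all add: decreasing_start_reflect[OF d])
qed

lemma increasing_end_le_decreasing_start:
  assumes d: "0 < d"
  shows "increasing_end d f \<le> decreasing_start d f"
proof (rule ccontr)
  assume "\<not> ?thesis"
  then obtain m where m: "decreasing_start d f < m" "m < increasing_end d f" using dense not_le by blast
  obtain s where s: "m < s" "s \<le> increasing_end d f" "strict_mono_on {0..s} f"
    using increasing_end_sup(4)[OF d m(2)] by blast
  obtain t where t: "t < m" "t \<in> {0..d}" "strict_antimono_on {t..d} f"
    using decreasing_start_approach[OF d m(1)] by blast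
  have sd: "s \<le> d" using s(2) increasing_end_sup(2)[OF d, of f] by simp
  have "f m < f s" using s(3) by (rule strict_mono_onD) (use s t in auto)
  moreover have "f m > f s" using monotone_onD[OF t(3), of m s] s t sd by simp
  ultimately show False by simp
qed

section \<open>The distance between the poles\<close>

text \<open>The derivative of a function along a path may be integrable only in the sense of Henstock and
Kurzweil, since the speed of a valid path can be unbounded near its finitely many corners. The
positive part of the integrand dominates it and has an integral in both senses, or else an
infinite Lebesgue integral.\<close>

lemma has_integral_le_nn_integral:
  fixes h :: "real \<Rightarrow> real"
  assumes h: "(h has_integral I) {a..b}"
  shows "ennreal I \<le> (\<integral>\<^sup>+x\<in>{a..b}. ennreal (h x) \<partial>lborel)"
proof -
  define k where "k x = max 0 (h x * indicator {a..b} x)" for x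
  have m: "(\<lambda>x. h x * indicator {a..b} x) \<in> borel_measurable lebesgue"
    by (rule has_integral_implies_lebesgue_measurable_real[OF h])
  then have km: "k \<in> borel_measurable lebesgue" unfolding k_def by measurable
  have eq: "(\<integral>\<^sup>+x\<in>{a..b}. ennreal (h x) \<partial>lborel) = integral\<^sup>N lebesgue (\<lambda>x. ennreal (k x))"
    unfolding nn_integral_completion
    by (intro nn_integral_cong) (auto simp: k_def max_def ennreal_neg split: split_indicator)
  show ?thesis
  proof (cases "integral\<^sup>N lebesgue (\<lambda>x. ennreal (k x)) = \<infinity>")
    case False
    then obtain r where r: "integral\<^sup>N lebesgue (\<lambda>x. ennreal (k x)) = ennreal r" "0 \<le> r"
      by (cases "integral\<^sup>N lebesgue (\<lambda>x. ennreal (k x))" rule: ennreal_cases) auto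
    have "(k has_integral r) UNIV"
      by (subst has_integral_iff_nn_integral_lebesgue) (use km r in \<open>auto simp: k_def\<close>)
    moreover have "((\<lambda>x. if x \<in> {a..b} then h x else 0) has_integral I) UNIV"
      using h by (subst has_integral_restrict_UNIV)
    ultimately have "I \<le> r"
      by (auto intro: has_integral_le[where f = "\<lambda>x. if x \<in> {a..b} then h x else 0" and g = k and S = UNIV] simp: k_def)
    then show ?thesis unfolding eq r by (rule ennreal_leI)
  next
    case True
    then show ?thesis unfolding eq by simp
  qed
qed

text \<open>Take for \<open>a\<close> the last parameter at the first level and for \<open>b\<close> the next parameter at the second. This
cuts out a piece of a path whose interior avoids both poles.\<close>

lemma arc_between_levels:
  fixes c :: "real \<Rightarrow> real"
  assumes c: "continuous_on {0..1} c" and ends: "c 0 = 1" "c 1 = - 1" and bd: "\<And>t. t \<in> {0..1} \<Longrightarrow> \<bar>c t\<bar> \<le> 1"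
  obtains a b where "0 \<le> a" "a < b" "b \<le> 1" "c a = 1" "c b = - 1" "\<And>t. a < t \<Longrightarrow> t < b \<Longrightarrow> \<bar>c t\<bar> < 1"
proof -
  have level: "compact {t \<in> {x..y}. c t = k}" if "continuous_on {x..y} c" for x y k
  proof -
    have "bounded {t \<in> {x..y}. c t = k}"
      by (rule bounded_subset[OF bounded_closed_interval[of x y]]) auto
    then show ?thesis
      using continuous_closed_preimage_constant[OF that closed_atLeastAtMost, of k]
      by (simp add: compact_eq_bounded_closed)
  qed
  have "compact {t \<in> {0..1}. c t = 1}" by (rule level[OF c])
  then obtain a where a: "a \<in> {0..1}" "c a = 1" "\<And>t. t \<in> {0..1} \<Longrightarrow> c t = 1 \<Longrightarrow> t \<le> a"
    using compact_attains_sup[of "{t \<in> {0..1}. c t = 1}"] ends by force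
  have ca: "continuous_on {a..1} c" using c by (rule continuous_on_subset) (use a in auto)
  have "compact {t \<in> {a..1}. c t = - 1}" by (rule level[OF ca])
  moreover have "1 \<in> {t \<in> {a..1}. c t = - 1}" using a ends by auto
  ultimately obtain b where b: "b \<in> {a..1}" "c b = - 1" "\<And>t. t \<in> {a..1} \<Longrightarrow> c t = - 1 \<Longrightarrow> b \<le> t"
    using compact_attains_inf[of "{t \<in> {a..1}. c t = - 1}"] by force
  show ?thesis
  proof
    show "a < b" using a(2) b(1,2) by (cases "a = b") auto
    show "\<bar>c t\<bar> < 1" if "a < t" "t < b" for t
      using a(3)[of t] b(3)[of t] bd[of t] that a(1) b(1) by (force simp: abs_le_iff abs_less_iff less_le)
  qed (use a b in auto)
qed

text \<open>Away from the poles the curve has polar coordinates \<open>(\<alpha>, \<omega>)\<close>, and its squared speed is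
\<open>\<alpha>'\<^sup>2 + f(\<alpha>)\<^sup>2 \<bar>\<omega>'\<bar>\<^sup>2\<close>.\<close>

lemma speed_ge_radial_speed:
  assumes g: "rot_symmetric g d f"
    and \<gamma>: "\<And>u. u \<in> {a<..<b} \<Longrightarrow> \<gamma> u \<in> S3" "\<And>u. u \<in> {a<..<b} \<Longrightarrow> \<bar>fst (\<gamma> u)\<bar> < 1"
    and t: "t \<in> {a<..<b}" and D: "\<gamma> differentiable (at t)"
  shows "((\<lambda>u. d / pi * arccos (fst (\<gamma> u))) has_real_derivative
      vector_derivative (\<lambda>u. d / pi * arccos (fst (\<gamma> u))) (at t)) (at t)"
    and "\<bar>vector_derivative (\<lambda>u. d / pi * arccos (fst (\<gamma> u))) (at t)\<bar>
      \<le> sqrt (g (\<gamma> t) (vector_derivative \<gamma> (at t)) (vector_derivative \<gamma> (at t)))"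
proof -
  define \<alpha> where "\<alpha> u = d / pi * arccos (fst (\<gamma> u))" for u
  define \<omega> where "\<omega> u = snd (\<gamma> u) /\<^sub>R norm (snd (\<gamma> u))" for u
  have d: "0 < d" by (rule rot_symmetric_pos[OF g])
  have n: "0 < norm (snd (\<gamma> u))" "sin (arccos (fst (\<gamma> u))) = norm (snd (\<gamma> u))" if "u \<in> {a<..<b}" for u
  proof -
    have s: "(fst (\<gamma> u))\<^sup>2 + (norm (snd (\<gamma> u)))\<^sup>2 = 1" using \<gamma>(1)[OF that] by (simp add: S3_iff)
    moreover have "(fst (\<gamma> u))\<^sup>2 < 1" using \<gamma>(2)[OF that] by (rule abs_less_one_sq)
    ultimately have "(norm (snd (\<gamma> u)))\<^sup>2 > 0" by linarith
    then show "0 < norm (snd (\<gamma> u))" by simp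
    have "sin (arccos (fst (\<gamma> u))) = sqrt (1 - (fst (\<gamma> u))\<^sup>2)"
      using \<gamma>(2)[OF that] by (intro sin_arccos) auto
    also have "\<dots> = norm (snd (\<gamma> u))" using s by (intro real_sqrt_unique) auto
    finally show "sin (arccos (fst (\<gamma> u))) = norm (snd (\<gamma> u))" .
  qed
  have pol: "\<gamma> u = polar d (\<alpha> u, \<omega> u)" if "u \<in> {a<..<b}" for u
    using n[OF that] \<gamma>(2)[OF that] d by (simp add: polar_def \<alpha>_def \<omega>_def prod_eq_iff)
  obtain \<gamma>' where G: "(\<gamma> has_vector_derivative \<gamma>') (at t)"
    using D by (auto simp: vector_derivative_works)
  have f1: "((\<lambda>u. fst (\<gamma> u)) has_real_derivative fst \<gamma>') (at t)"
    using bounded_linear.has_vector_derivative[OF bounded_linear_fst G]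
    by (simp add: has_real_derivative_iff_has_vector_derivative)
  have f2: "(\<lambda>u. snd (\<gamma> u)) differentiable (at t)"
    using bounded_linear.has_vector_derivative[OF bounded_linear_snd G]
    by (auto intro: differentiableI_vector)
  have "(arccos has_real_derivative inverse (- sqrt (1 - (fst (\<gamma> t))\<^sup>2))) (at (fst (\<gamma> t)))"
    using \<gamma>(2)[OF t] by (intro DERIV_arccos) auto
  from DERIV_cmult[OF DERIV_chain2[OF this f1], of "d / pi"]
  obtain A where A: "(\<alpha> has_real_derivative A) (at t)" unfolding \<alpha>_def by blast
  have vA: "vector_derivative \<alpha> (at t) = A"
    using A by (simp add: has_real_derivative_iff_has_vector_derivative vector_derivative_at)
  have \<alpha>eq: "(\<lambda>u. d / pi * arccos (fst (\<gamma> u))) = \<alpha>" by (simp add: \<alpha>_def fun_eq_iff)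
  show "((\<lambda>u. d / pi * arccos (fst (\<gamma> u))) has_real_derivative
      vector_derivative (\<lambda>u. d / pi * arccos (fst (\<gamma> u))) (at t)) (at t)"
    unfolding \<alpha>eq vA by (rule A)
  have "(\<lambda>u. norm (snd (\<gamma> u))) differentiable (at t)"
    using f2 n(1)[OF t] by (intro differentiable_compose[of norm, OF differentiable_norm_at]) auto
  then have "(\<lambda>u. inverse (norm (snd (\<gamma> u)))) differentiable (at t)"
    using n(1)[OF t] by (intro differentiable_inverse) auto
  then have "\<omega> differentiable (at t)"
    unfolding \<omega>_def using f2 by (intro differentiable_scaleR)
  then obtain \<Omega> where W: "(\<omega> has_derivative \<Omega>) (at t)" by (auto simp: differentiable_def)
  have w1: "norm (\<omega> u) = 1" if "u \<in> {a<..<b}" for u using n(1)[OF that] by (simp add: \<omega>_def)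
  \<comment> \<open>A curve of unit vectors has a derivative orthogonal to it.\<close>
  have "((\<lambda>u. \<omega> u \<bullet> \<omega> u) has_derivative (\<lambda>h. \<omega> t \<bullet> \<Omega> h + \<Omega> h \<bullet> \<omega> t)) (at t)"
    by (rule has_derivative_inner[OF W W])
  moreover have "((\<lambda>u. \<omega> u \<bullet> \<omega> u) has_derivative (\<lambda>h. 0)) (at t)"
    by (rule has_derivative_transform_within_open[OF has_derivative_const[of 1] open_greaterThanLessThan t])
      (use w1 in \<open>simp add: dot_square_norm\<close>)
  ultimately have "(\<lambda>h. \<omega> t \<bullet> \<Omega> h + \<Omega> h \<bullet> \<omega> t) = (\<lambda>h. 0)" by (rule has_derivative_unique)
  then have o: "\<omega> t \<bullet> \<Omega> 1 = 0" by (metis (no_types, lifting) inner_commute mult_2 mult_eq_0_iff zero_neq_numeral)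
  have \<alpha>t: "0 < \<alpha> t" "\<alpha> t < d"
    using arccos_lt_bounded[of "fst (\<gamma> t)"] \<gamma>(2)[OF t] d by (auto simp: \<alpha>_def field_simps)
  have der: "((\<lambda>u. polar d (\<alpha> u, \<omega> u)) has_derivative (\<lambda>h. h *\<^sub>R \<gamma>')) (at t)"
    by (rule has_derivative_transform_within_open[OF G[unfolded has_vector_derivative_def] open_greaterThanLessThan t])
      (rule pol)
  have "g (\<gamma> t) \<gamma>' \<gamma>' = pullback g (\<lambda>u. polar d (\<alpha> u, \<omega> u)) t 1 1"
    using frechet_derivative_at[OF der] pol[OF t] by (simp add: pullback_def) (metis scaleR_one)
  also have "\<dots> = A * A + (f (\<alpha> t))\<^sup>2 * (\<Omega> 1 \<bullet> \<Omega> 1)"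
    using pullback_polar_curve[OF g A[unfolded has_field_derivative_def] W \<alpha>t w1[OF t] o o] by simp
  finally have "g (\<gamma> t) \<gamma>' \<gamma>' \<ge> A\<^sup>2" by (simp add: power2_eq_square)
  then have "\<bar>A\<bar> \<le> sqrt (g (\<gamma> t) \<gamma>' \<gamma>')" using real_sqrt_le_mono by fastforce
  then show "\<bar>vector_derivative (\<lambda>u. d / pi * arccos (fst (\<gamma> u))) (at t)\<bar>
      \<le> sqrt (g (\<gamma> t) (vector_derivative \<gamma> (at t)) (vector_derivative \<gamma> (at t)))"
    unfolding \<alpha>eq vA by (simp add: vector_derivative_at[OF G])
qed

text \<open>On a piece of the path between the poles the radial coordinate runs from \<open>0\<close> to \<open>d\<close>. It is
continuous on the closed piece and differentiable inside, apart from finitely many corners, so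
its derivative integrates to \<open>d\<close>.\<close>

lemma pole_curve_length:
  assumes g: "rot_symmetric g d f" and v: "valid_path \<gamma>" and S: "path_image \<gamma> \<subseteq> S3"
    and ends: "pathstart \<gamma> = (1, 0)" "pathfinish \<gamma> = (- 1, 0)"
  shows "ennreal d \<le> curve_length g \<gamma>"
proof -
  have d: "0 < d" by (rule rot_symmetric_pos[OF g])
  have cont: "continuous_on {0..1} \<gamma>"
    using v by (simp add: valid_path_def piecewise_C1_differentiable_on_def)
  obtain T D where T: "finite T" "\<And>t. t \<in> {0..1} - T \<Longrightarrow> (\<gamma> has_vector_derivative D t) (at t)"
    using v unfolding valid_path_def piecewise_C1_differentiable_on_def C1_differentiable_on_def by blast
  have S': "\<gamma> t \<in> S3" if "t \<in> {0..1}" for t using S that by (auto simp: path_image_def)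
  have c: "continuous_on {0..1} (\<lambda>t. fst (\<gamma> t))" by (intro continuous_intros cont)
  have bd: "\<bar>fst (\<gamma> t)\<bar> \<le> 1" if "t \<in> {0..1}" for t
  proof -
    have "(fst (\<gamma> t))\<^sup>2 \<le> 1"
      using S'[OF that] zero_le_power2[of "norm (snd (\<gamma> t))"] unfolding S3_iff by linarith
    then show ?thesis by (simp add: abs_square_le_1)
  qed
  have e: "fst (\<gamma> 0) = 1" "fst (\<gamma> 1) = - 1" using ends by (simp_all add: pathstart_def pathfinish_def)
  obtain a b where ab: "0 \<le> a" "a < b" "b \<le> 1" "fst (\<gamma> a) = 1" "fst (\<gamma> b) = - 1"
    "\<And>t. a < t \<Longrightarrow> t < b \<Longrightarrow> \<bar>fst (\<gamma> t)\<bar> < 1"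
    using arc_between_levels[OF c e bd] by metis
  let ?\<alpha> = "\<lambda>u. d / pi * arccos (fst (\<gamma> u))"
  let ?h = "\<lambda>t. vector_derivative ?\<alpha> (at t)"
  let ?v = "\<lambda>t. sqrt (g (\<gamma> t) (vector_derivative \<gamma> (at t)) (vector_derivative \<gamma> (at t)))"
  note sp = speed_ge_radial_speed[OF g, of a b \<gamma>]
  have df: "\<gamma> differentiable (at t)" if "t \<in> {a<..<b} - T" for t
    using T(2)[of t] that ab by (auto intro: differentiableI_vector)
  have in01: "\<gamma> t \<in> S3" "\<bar>fst (\<gamma> t)\<bar> < 1" if "t \<in> {a<..<b}" for t
    using that S'[of t] ab by auto
  have "(?h has_integral (?\<alpha> b - ?\<alpha> a)) {a..b}"
  proof (rule fundamental_theorem_of_calculus_interior_strong[OF T(1)])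
    show "(?\<alpha> has_vector_derivative ?h t) (at t)" if "t \<in> {a<..<b} - T" for t
      using sp(1)[OF in01 _ df[OF that]] that by (simp add: has_real_derivative_iff_has_vector_derivative)
    have "continuous_on {a..b} (\<lambda>t. fst (\<gamma> t))" using c by (rule continuous_on_subset) (use ab in auto)
    then show "continuous_on {a..b} ?\<alpha>"
      using bd ab by (intro continuous_on_mult continuous_on_const continuous_on_arccos) (auto simp: abs_le_iff minus_le_iff)
  qed (use ab in simp)
  then have "(?h has_integral d) {a..b}" using d by (simp add: ab)
  then have "ennreal d \<le> (\<integral>\<^sup>+t\<in>{a..b}. ennreal (?h t) \<partial>lborel)"
    by (rule has_integral_le_nn_integral)
  also have "\<dots> \<le> (\<integral>\<^sup>+t\<in>{0..1}. ennreal (?v t) \<partial>lborel)"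
  proof (rule nn_integral_mono_AE)
    have "finite ({a, b} \<union> T)" using T(1) by simp
    then have "AE t in lborel. t \<notin> {a, b} \<union> T"
      by (intro AE_not_in finite_imp_null_set_lborel)
    then show "AE t in lborel. ennreal (?h t) * indicator {a..b} t \<le> ennreal (?v t) * indicator {0..1} t"
    proof eventually_elim
      case (elim t)
      show ?case
      proof (cases "t \<in> {a..b}")
        case True
        then have t: "t \<in> {a<..<b} - T" using elim by (auto simp: less_le)
        have "\<bar>?h t\<bar> \<le> ?v t" by (rule sp(2)[OF in01 _ df[OF t]]) (use t in auto)
        then show ?thesis using True ab by (auto intro!: ennreal_leI)
      qed simp
    qed
  qed
  also have "\<dots> = curve_length g \<gamma>" by (simp add: curve_length_def)
  finally show ?thesis .
qed

lemma Diam_ge: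
  assumes g: "rot_symmetric g d f"
  shows "ennreal d \<le> Diam g"
proof -
  have "ennreal d \<le> riemannian_dist g (1, 0) (- 1, 0)"
    unfolding riemannian_dist_def using pole_curve_length[OF g] by (intro Inf_greatest) blast
  also have "\<dots> \<le> Diam g"
    unfolding Diam_def
    by (rule SUP_upper2[of "(1, 0)"], simp add: S3_iff, rule SUP_upper) (simp add: S3_iff)
  finally show ?thesis .
qed

section \<open>Extended warping functions\<close>

locale scal_nonneg_sphere =
  fixes g :: "pt tensor2" and d :: real and f :: "real \<Rightarrow> real"
  assumes g: "rot_symmetric g d f" and K: "nonneg_scalar_curvature g"
begin

abbreviation "F \<equiv> extend_by_zero d f"
abbreviation "a \<equiv> increasing_end d f"
abbreviation "b \<equiv> decreasing_start d f"

lemma d: "0 < d" by (rule rot_symmetric_pos[OF g])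

lemma f_ends: "f 0 = 0" "f d = 0"
  using g unfolding rot_symmetric_def by simp_all

lemma f_nonneg: "s \<in> {0..d} \<Longrightarrow> 0 \<le> f s"
  using rot_chart.f_pos[OF rot_chart_id[OF g], of s] f_ends by (cases "s = 0 \<or> s = d") auto

lemma f_lipschitz:
  assumes "x \<in> {0..d}" "y \<in> {0..d}" shows "\<bar>f x - f y\<bar> \<le> \<bar>x - y\<bar>"
proof -
  obtain f' where f': "\<And>s. s \<in> {0..d} \<Longrightarrow> (f has_real_derivative f' s) (at s within {0..d})"
    "continuous_on {0..d} f'" "f' 0 = 1" "f' d = - 1"
    "\<And>s. 0 < s \<Longrightarrow> s < d \<Longrightarrow> \<exists>f2. (f' has_real_derivative f2) (at s)"
    using rot_symmetric_derivative[OF g] by blast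
  have "norm (f x - f y) \<le> 1 * norm (x - y)"
    by (rule field_differentiable_bound[OF _ f'(1)]) (use slope_bound[OF g K f'] assms in auto)
  then show ?thesis by simp
qed

text \<open>Extension by zero keeps the Lipschitz constant because \<open>f\<close> vanishes at \<open>d\<close>.\<close>

lemma F_lipschitz:
  assumes "0 \<le> x" "0 \<le> y" shows "\<bar>F x - F y\<bar> \<le> \<bar>x - y\<bar>"
proof -
  have *: "\<bar>f x\<bar> \<le> \<bar>x - y\<bar>" if "0 \<le> x" "x \<le> d" "d < y" for x y
    using f_lipschitz[of x d] f_ends d that by simp
  show ?thesis
    using f_lipschitz[of x y] *[of x y] *[of y x] assms
    by (auto simp: extend_by_zero_def abs_minus_commute)
qed

lemma F_mono: "0 \<le> x \<Longrightarrow> x \<le> y \<Longrightarrow> y < a \<Longrightarrow> F x \<le> F y"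
proof -
  assume xy: "0 \<le> x" "x \<le> y" "y < a"
  obtain s where s: "y < s" "s \<le> a" "strict_mono_on {0..s} f"
    using increasing_end_sup(4)[OF d xy(3)] by blast
  have "f x \<le> f y" using strict_mono_onD[OF s(3), of x y] s xy by (cases "x = y") auto
  moreover have "y \<le> d" using s increasing_end_sup(2)[OF d, of f] by simp
  ultimately show ?thesis using xy by (simp add: extend_by_zero_def)
qed

lemma F_antimono: "b < x \<Longrightarrow> x \<le> y \<Longrightarrow> F y \<le> F x"
proof -
  assume xy: "b < x" "x \<le> y"
  obtain s where s: "s < x" "s \<in> {0..d}" "strict_antimono_on {s..d} f"
    using decreasing_start_approach[OF d xy(1)] by blast
  show ?thesis
  proof (cases "y \<le> d")
    case True
    then have "f y \<le> f x" using monotone_onD[OF s(3), of x y] s xy by (cases "x = y") auto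
    then show ?thesis using True xy by (simp add: extend_by_zero_def)
  next
    case False
    then show ?thesis using f_nonneg[of x] s xy by (simp add: extend_by_zero_def)
  qed
qed

text \<open>A minimum of \<open>f\<close> on \<open>[a, b]\<close> is a critical point: in the interior by Fermat's criterion, at the ends
because \<open>a\<close> and \<open>b\<close> are critical.\<close>

lemma F_ge:
  assumes A: "ennreal A \<le> MinA g" and s: "a \<le> s" "s \<le> b"
  shows "sqrt (A / (4 * pi)) \<le> F s"
proof -
  obtain f' where f': "\<And>s. s \<in> {0..d} \<Longrightarrow> (f has_real_derivative f' s) (at s within {0..d})"
    and c: "continuous_on {0..d} f'" and ends: "f' 0 = 1" "f' d = - 1"
    and "\<And>s. 0 < s \<Longrightarrow> s < d \<Longrightarrow> \<exists>f2. (f' has_real_derivative f2) (at s)"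
    using rot_symmetric_derivative[OF g] by blast
  have ends': "0 < f' 0" "f' d < 0" using ends by simp_all
  have f'i: "(f has_real_derivative f' s) (at s)" if "0 < s" "s < d" for s
    using f'[of s] that at_within_Icc_at[of 0 s d] by simp
  note ac = increasing_end_critical[OF d f' c ends'] and bc = decreasing_start_critical[OF d f' c ends']
  have "continuous_on {0..d} f" using f' by (rule DERIV_continuous_on)
  then have "continuous_on {a..b} f" by (rule continuous_on_subset) (use ac bc in auto)
  moreover have "{a..b} \<noteq> {}" using s by auto
  ultimately obtain x where x: "x \<in> {a..b}" "\<And>y. y \<in> {a..b} \<Longrightarrow> f x \<le> f y"
    using continuous_attains_inf[OF compact_Icc] by blast
  have x0: "0 < x" "x < d" using x(1) ac bc by auto
  have "f' x = 0"
  proof (cases "a < x \<and> x < b")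
    case True
    show ?thesis
      by (rule DERIV_local_min[OF f'i[OF x0], of "min (x - a) (b - x)"])
        (use True in \<open>auto intro!: x(2)\<close>)
  next
    case False
    then have "x = a \<or> x = b" using x(1) by auto
    then show ?thesis using ac bc by auto
  qed
  then have "sqrt (A / (4 * pi)) \<le> f x" using critical_radius_bound[OF g f'i A x0] by blast
  also have "\<dots> \<le> f s" using s by (intro x(2)) simp
  also have "\<dots> = F s" using s bc by (simp add: extend_by_zero_def)
  finally show ?thesis .
qed

end

section \<open>Convergence\<close>

theorem theorem4p1:
  fixes D A A_inf B_inf :: real
    and d :: "nat \<Rightarrow> real"
    and f :: "nat \<Rightarrow> real \<Rightarrow> real"
    and g :: "nat \<Rightarrow> pt tensor2"
    and \<sigma> :: "nat \<Rightarrow> nat"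
  assumes "0 < D" and "0 < A"
    and "\<And>j. rot_symmetric (g j) (d j) (f j)"
    and "\<And>j. Diam (g j) \<le> ennreal D"
    and "\<And>j. nonneg_scalar_curvature (g j)"
    and "\<And>j. ennreal A \<le> MinA (g j)"
    and "strict_mono \<sigma>"
    and "(\<lambda>j. increasing_end (d (\<sigma> j)) (f (\<sigma> j))) \<longlonglongrightarrow> A_inf"
    and "(\<lambda>j. decreasing_start (d (\<sigma> j)) (f (\<sigma> j))) \<longlonglongrightarrow> B_inf"
  shows "\<exists>(\<rho> :: nat \<Rightarrow> nat) (f_inf :: real \<Rightarrow> real).
     strict_mono \<rho> \<and>
     uniform_limit {0..D} (\<lambda>j. extend_by_zero (d (\<sigma> (\<rho> j))) (f (\<sigma> (\<rho> j)))) f_inf sequentially \<and>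
     1-lipschitz_on {0..D} f_inf \<and>
     (f_inf 0 = 0 \<and> mono_on {0..A_inf} f_inf) \<and>
     (A_inf \<noteq> B_inf \<longrightarrow> (\<forall>s\<in>{A_inf..B_inf}. sqrt (A / (4 * pi)) \<le> f_inf s)) \<and>
     (f_inf D = 0 \<and> antimono_on {B_inf..D} f_inf)"
proof -
  define F where "F j = extend_by_zero (d (\<sigma> j)) (f (\<sigma> j))" for j
  define a where "a j = increasing_end (d (\<sigma> j)) (f (\<sigma> j))" for j
  define b where "b j = decreasing_start (d (\<sigma> j)) (f (\<sigma> j))" for j
  define c where "c = sqrt (A / (4 * pi))"
  have S: "scal_nonneg_sphere (g j) (d j) (f j)" for j
    using assms(3,5) by unfold_locales
  have lipF: "\<bar>F j x - F j y\<bar> \<le> \<bar>x - y\<bar>" if "0 \<le> x" "0 \<le> y" for j x y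
    unfolding F_def using scal_nonneg_sphere.F_lipschitz[OF S that] .
  have monoF: "F j x \<le> F j y" if "0 \<le> x" "x \<le> y" "y < a j" for j x y
    unfolding F_def using scal_nonneg_sphere.F_mono[OF S] that by (simp add: a_def)
  have antiF: "F j y \<le> F j x" if "b j < x" "x \<le> y" for j x y
    unfolding F_def using scal_nonneg_sphere.F_antimono[OF S] that by (simp add: b_def)
  have geF: "c \<le> F j s" if "a j \<le> s" "s \<le> b j" for j s
    unfolding F_def c_def using scal_nonneg_sphere.F_ge[OF S assms(6)] that by (simp add: a_def b_def)
  have d0: "0 < d j" for j by (rule rot_symmetric_pos[OF assms(3)])
  have dD: "d j \<le> D" for j
    using order_trans[OF Diam_ge[OF assms(3)] assms(4)] assms(1) by (simp add: ennreal_le_iff)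
  have F0: "F j 0 = 0" and FD: "F j D = 0" for j
    using scal_nonneg_sphere.f_ends[OF S, of "\<sigma> j"] d0[of "\<sigma> j"] dD[of "\<sigma> j"]
    by (auto simp: F_def extend_by_zero_def)
  have ab: "0 \<le> a j" "a j \<le> b j" "b j \<le> D" for j
  proof -
    show "0 \<le> a j" unfolding a_def by (rule increasing_end_sup(1)[OF d0])
    show "a j \<le> b j" unfolding a_def b_def by (rule increasing_end_le_decreasing_start[OF d0])
    have "b j \<le> d (\<sigma> j)"
      unfolding b_def decreasing_start_reflect[OF d0] using increasing_end_sup(1)[OF d0] by simp
    then show "b j \<le> D" using dD order_trans by blast
  qed
  have alim: "a \<longlonglongrightarrow> A_inf" and blim: "b \<longlonglongrightarrow> B_inf"
    using assms(8,9) by (simp_all add: a_def[abs_def] b_def[abs_def])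
  have AB: "0 \<le> A_inf" "A_inf \<le> B_inf" "B_inf \<le> D"
    using LIMSEQ_le_const[OF alim] LIMSEQ_le[OF alim blim] LIMSEQ_le_const2[OF blim] ab by blast+
  have bound: "norm (F j x) \<le> D" if "x \<in> {0..D}" for j x
    using lipF[of x 0 j] F0 that by simp
  obtain h \<rho> where \<rho>: "strict_mono (\<rho> :: nat \<Rightarrow> nat)"
    and conv: "\<And>e. 0 < e \<Longrightarrow> \<exists>N. \<forall>n x. n \<ge> N \<and> x \<in> {0..D} \<longrightarrow> norm (F (\<rho> n) x - h x) < e"
  proof (rule Arzela_Ascoli[of "{0..D}" F D])
    show "\<exists>\<delta>. 0 < \<delta> \<and> (\<forall>n y. y \<in> {0..D} \<and> norm (x - y) < \<delta> \<longrightarrow> norm (F n x - F n y) < e)"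
      if "x \<in> {0..D}" "0 < e" for x e
      using that lipF by (intro exI[of _ e]) (auto intro: le_less_trans)
  qed (use bound in auto)
  have unif: "uniform_limit {0..D} (\<lambda>j. F (\<rho> j)) h sequentially"
    unfolding uniform_limit_iff eventually_sequentially dist_norm using conv by meson
  have lim: "(\<lambda>j. F (\<rho> j) x) \<longlonglongrightarrow> h x" if "x \<in> {0..D}" for x
    using tendsto_uniform_limitI[OF unif that] .
  have alim': "(\<lambda>j. a (\<rho> j)) \<longlonglongrightarrow> A_inf" and blim': "(\<lambda>j. b (\<rho> j)) \<longlonglongrightarrow> B_inf"
    using LIMSEQ_subseq_LIMSEQ[OF alim \<rho>] LIMSEQ_subseq_LIMSEQ[OF blim \<rho>] by (simp_all add: o_def)
  have liph: "\<bar>h x - h y\<bar> \<le> \<bar>x - y\<bar>" if xy: "x \<in> {0..D}" "y \<in> {0..D}" for x y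
    by (rule LIMSEQ_le_const2[OF tendsto_rabs[OF tendsto_diff[OF lim[OF xy(1)] lim[OF xy(2)]]]])
      (use lipF xy in auto)
  have h0: "h 0 = 0" and hD: "h D = 0"
    using LIMSEQ_unique[OF lim[of 0]] LIMSEQ_unique[OF lim[of D]] assms(1) by (auto simp: F0 FD)
  \<comment> \<open>A point strictly below the limit \<open>A_inf\<close> is eventually below the interval ends themselves.\<close>
  have inch: "h x \<le> h y" if "0 \<le> x" "x \<le> y" "y < A_inf" for x y
  proof (rule tendsto_le[OF trivial_limit_sequentially lim lim])
    show "\<forall>\<^sub>F j in sequentially. F (\<rho> j) x \<le> F (\<rho> j) y"
      using order_tendstoD(1)[OF alim' that(3)] by eventually_elim (use monoF that in simp)
  qed (use that AB in auto)
  have dech: "h y \<le> h x" if "B_inf < x" "x \<le> y" "y \<le> D" for x y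
  proof (rule tendsto_le[OF trivial_limit_sequentially lim lim])
    show "\<forall>\<^sub>F j in sequentially. F (\<rho> j) y \<le> F (\<rho> j) x"
      using order_tendstoD(2)[OF blim' that(1)] by eventually_elim (use antiF that in simp)
  qed (use that AB in auto)
  have "mono_on {0..A_inf} h"
  proof (rule mono_onI)
    fix x y assume xy: "x \<in> {0..A_inf}" "y \<in> {0..A_inf}" "x \<le> y"
    show "h x \<le> h y"
    proof (cases "x = y")
      case False
      show ?thesis
      proof (rule field_le_epsilon)
        fix e :: real assume e: "0 < e"
        \<comment> \<open>The end point is approached from inside, at a cost of \<open>e\<close> by the Lipschitz bound.\<close>
        define z where "z = max x (y - e)"
        have z: "x \<le> z" "z < y" "y - z \<le> e" using False xy(3) e by (auto simp: z_def)
        have "h x \<le> h z" using inch[of x z] z xy by simp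
        moreover have "\<bar>h z - h y\<bar> \<le> \<bar>z - y\<bar>" using liph[of z y] z xy AB by simp
        ultimately show "h x \<le> h y + e" using z by linarith
      qed
    qed simp
  qed
  moreover have "antimono_on {B_inf..D} h"
  proof (rule monotone_onI)
    fix x y assume xy: "x \<in> {B_inf..D}" "y \<in> {B_inf..D}" "x \<le> y"
    show "h x \<ge> h y"
    proof (cases "x = y")
      case False
      show ?thesis
      proof (rule field_le_epsilon)
        fix e :: real assume e: "0 < e"
        define z where "z = min y (x + e)"
        have z: "z \<le> y" "x < z" "z - x \<le> e" using False xy(3) e by (auto simp: z_def)
        have "h y \<le> h z" using dech[of z y] z xy by simp
        moreover have "\<bar>h z - h x\<bar> \<le> \<bar>z - x\<bar>" using liph[of z x] z xy AB by simp
        ultimately show "h y \<le> h x + e" using z by linarith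
      qed
    qed simp
  qed
  moreover have "c \<le> h s" if s: "s \<in> {A_inf..B_inf}" for s
  proof -
    \<comment> \<open>The nearest point to \<open>s\<close> in the \<open>j\<close>-th interval, where the lower bound is known.\<close>
    define t where "t j = max (a (\<rho> j)) (min (b (\<rho> j)) s)" for j
    have "t \<longlonglongrightarrow> max A_inf (min B_inf s)"
      unfolding t_def[abs_def] by (intro tendsto_max tendsto_min alim' blim' tendsto_const)
    then have "t \<longlonglongrightarrow> s" using s by simp
    then have l: "(\<lambda>j. c - \<bar>s - t j\<bar>) \<longlonglongrightarrow> c - \<bar>s - s\<bar>" by (intro tendsto_intros)
    have sD: "s \<in> {0..D}" using s AB by simp
    have "c - \<bar>s - t j\<bar> \<le> F (\<rho> j) s" for j
    proof -
      have t: "a (\<rho> j) \<le> t j" "t j \<le> b (\<rho> j)" using ab(2)[of "\<rho> j"] by (auto simp: t_def)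
      have "c \<le> F (\<rho> j) (t j)" by (rule geF[OF t])
      moreover have "\<bar>F (\<rho> j) s - F (\<rho> j) (t j)\<bar> \<le> \<bar>s - t j\<bar>"
        using lipF sD t ab(1)[of "\<rho> j"] by simp
      ultimately show ?thesis by linarith
    qed
    then have "c - \<bar>s - s\<bar> \<le> h s" using LIMSEQ_le[OF l lim[OF sD]] by blast
    then show ?thesis by simp
  qed
  moreover have "1-lipschitz_on {0..D} h"
    by (rule lipschitz_onI) (use liph in \<open>simp_all add: dist_real_def\<close>)
  ultimately show ?thesis
    using \<rho> unif h0 hD unfolding F_def c_def by blast
qed

end
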